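(* Suppose $t$ and $\tilde t$ are quasi-homogeneous holomorphic curves of rank $n$; let $t_0,\dots,t_{n-1}$ be the atoms of $t$. (1) If $\Lambda(t)\ge 2$, then $t$ is similar to the $n$-fold direct sum of its atoms $t_0\oplus t_1\oplus\cdots\oplus t_{n-1}$. (2) If $\Lambda(t)=\Lambda(\tilde t)<2$ and $\theta_{i,i+1}=\tilde\theta_{i,i+1}$ for $i=0,1,\dots,n-2$, then $t$ and $\tilde t$ are similar if and only if they are equal.
   Context: $\mathbb D$ is the open unit disc. For $\lambda>0$, $\mathbb A^{(\lambda)}(\mathbb D)$ is the Hilbert space of holomorphic functions on $\mathbb D$ with reproducing kernel $(1-z\bar w)^{-\lambda}$. $B_n(\mathbb D)$ is the Cowen–Douglas class: bounded operators $T$ on a separable Hilbert space such that for each $w\in\mathbb D$, $T-w$ is surjective and $\dim\ker(T-w)=n$, and the subspaces $\ker(T-w)$ span a dense subspace. A quasi-homogeneous holomorphic curve $t$ of rank $n\ge2$ is given by: $\lambda_0>0$, a valency $\Lambda(t)>0$, $\lambda_i=\lambda_0+i\Lambda(t)$, and complex constants $\mu_{i,j}$ ($0\le i\le j\le n-1$) with $\mu_{i,i}=1$ and $\mu_{i,i+1}\ne0$. Put $\mathcal H_i=\mathbb A^{(\lambda_i)}(\mathbb D)$, $\mathcal H=\mathcal H_0\oplus\cdots\oplus\mathcal H_{n-1}$, atoms $t_i(w)(z)=(1-zw)^{-\lambda_i}\in\mathcal H_i$, frame $\gamma_j(w)=\sum_{i=0}^j\mu_{i,j}t_i^{(j-i)}(w)$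 (derivatives in $w$), and $t(w)=\mathrm{span}\{\gamma_0(w),\dots,\gamma_{n-1}(w)\}$. Standing assumption: the linear transformation $T$ with $T\gamma_j(w)=w\gamma_j(w)$ extends to a bounded operator on $\mathcal H$ belonging to $B_n(\mathbb D)$. The direct sum of atoms $t_0\oplus\cdots\oplus t_{n-1}$ is the curve $w\mapsto\mathrm{span}\{t_0(w),\dots,t_{n-1}(w)\}\subseteq\mathcal H$. Two curves $t,\tilde t$ in $\mathcal H,\tilde{\mathcal H}$ are similar if there is a bounded invertible operator $X:\mathcal H\to\tilde{\mathcal H}$ with $X\,t(w)=\tilde t(w)$ for all $w\in\mathbb D$. The second fundamental form $\theta_{i,i+1}$ of the inclusion of the line bundle spanned by $t_i$ in the rank-two bundle with frame $\{t_i,\ \mu_{i,i+1}t_i^{(1)}+t_{i+1}\}$ is $$\theta_{i,i+1}=\frac{\mu_{i,i+1}\,\mathcal K_{t_i}\,d\bar w}{\Big(\frac{\|t_{i+1}\|^2}{\|t_i\|^2}-|\mu_{i,i+1}|^2\,\mathcal K_{t_i}\Big)^{1/2}},\qquad \mathcal K_{t_i}=-\partial\bar\partial\log\|t_i\|^2,$$ and $\tilde\theta_{i,i+1}$ is defined in the same way from $\tilde t$. *)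

theory Defs
  imports "HOL-Analysis.Analysis" "HOL-Library.Function_Algebras"
begin

text \<open>
  The distribution has no class of complex vector spaces, so every Hilbert space is a linear
  space of functions from some set of points to the complex numbers, with the pointwise
  operations and an explicit inner product (linear in the first argument).
\<close>

definition cscale :: "complex \<Rightarrow> ('a \<Rightarrow> complex) \<Rightarrow> 'a \<Rightarrow> complex"
  where "cscale c f = (\<lambda>x. c * f x)"

global_interpretation cfun: vector_space cscale
  by standard (auto simp: cscale_def fun_eq_iff algebra_simps)

record 'a hspace =
  hcar :: "('a \<Rightarrow> complex) set"
  inprod :: "('a \<Rightarrow> complex) \<Rightarrow> ('a \<Rightarrow> complex) \<Rightarrow> complex"

definition hnorm :: "'a hspace \<Rightarrow> ('a \<Rightarrow> complex) \<Rightarrow> real"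
  where "hnorm H f = sqrt (Re (inprod H f f))"

definition hilbert_space :: "'a hspace \<Rightarrow> bool"
  where "hilbert_space H \<longleftrightarrow>
    cfun.subspace (hcar H) \<and>
    (\<forall>f\<in>hcar H. \<forall>g\<in>hcar H. \<forall>h\<in>hcar H. inprod H (f + g) h = inprod H f h + inprod H g h) \<and>
    (\<forall>c. \<forall>f\<in>hcar H. \<forall>h\<in>hcar H. inprod H (cscale c f) h = c * inprod H f h) \<and>
    (\<forall>f\<in>hcar H. \<forall>g\<in>hcar H. inprod H g f = cnj (inprod H f g)) \<and>
    (\<forall>f\<in>hcar H. f \<noteq> 0 \<longrightarrow> Re (inprod H f f) > 0) \<and>
    (\<forall>F. (\<forall>k. F k \<in> hcar H) \<and>
         (\<forall>e>0. \<exists>N. \<forall>k\<ge>N. \<forall>m\<ge>N. hnorm H (F k - F m) < e) \<longrightarrow>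
       (\<exists>f\<in>hcar H. (\<lambda>k::nat. hnorm H (F k - f)) \<longlonglongrightarrow> 0))"

definition hdense :: "'a hspace \<Rightarrow> ('a \<Rightarrow> complex) set \<Rightarrow> bool"
  where "hdense H S \<longleftrightarrow> S \<subseteq> hcar H \<and> (\<forall>f\<in>hcar H. \<forall>e>0. \<exists>g\<in>S. hnorm H (f - g) < e)"

definition separable_hspace :: "'a hspace \<Rightarrow> bool"
  where "separable_hspace H \<longleftrightarrow> (\<exists>S. countable S \<and> hdense H S)"

definition bounded_op ::
    "'a hspace \<Rightarrow> 'b hspace \<Rightarrow> (('a \<Rightarrow> complex) \<Rightarrow> ('b \<Rightarrow> complex)) \<Rightarrow> bool"
  where "bounded_op H H' X \<longleftrightarrow>
    (\<forall>f\<in>hcar H. X f \<in> hcar H') \<and>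
    (\<forall>f\<in>hcar H. \<forall>g\<in>hcar H. X (f + g) = X f + X g) \<and>
    (\<forall>c. \<forall>f\<in>hcar H. X (cscale c f) = cscale c (X f)) \<and>
    (\<exists>C. \<forall>f\<in>hcar H. hnorm H' (X f) \<le> C * hnorm H f)"

definition bounded_invertible_op ::
    "'a hspace \<Rightarrow> 'b hspace \<Rightarrow> (('a \<Rightarrow> complex) \<Rightarrow> ('b \<Rightarrow> complex)) \<Rightarrow> bool"
  where "bounded_invertible_op H H' X \<longleftrightarrow>
    bounded_op H H' X \<and>
    (\<exists>Y. bounded_op H' H Y \<and> (\<forall>f\<in>hcar H. Y (X f) = f) \<and> (\<forall>g\<in>hcar H'. X (Y g) = g))"

abbreviation disc :: "complex set"
  where "disc \<equiv> ball 0 1"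

text \<open>
  A curve assigns to every point of the disc a linear subspace of the ambient Hilbert space;
  its values outside the disc are irrelevant.
\<close>

definition similar_curves ::
    "'a hspace \<Rightarrow> (complex \<Rightarrow> ('a \<Rightarrow> complex) set) \<Rightarrow>
     'b hspace \<Rightarrow> (complex \<Rightarrow> ('b \<Rightarrow> complex) set) \<Rightarrow> bool"
  where "similar_curves H t H' t' \<longleftrightarrow>
    (\<exists>X. bounded_invertible_op H H' X \<and> (\<forall>w\<in>disc. X ` t w = t' w))"

definition eigenspace ::
    "'a hspace \<Rightarrow> (('a \<Rightarrow> complex) \<Rightarrow> ('a \<Rightarrow> complex)) \<Rightarrow> complex \<Rightarrow> ('a \<Rightarrow> complex) set"
  where "eigenspace H T w = {f \<in> hcar H. T f - cscale w f = 0}"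

text \<open>
  An infinite-dimensional space has \<open>cfun.dim\<close> equal to \<open>0\<close>, so for \<open>n \<ge> 1\<close> the condition on the
  dimension includes that the eigenspaces are finite-dimensional.
\<close>

definition cowen_douglas ::
    "nat \<Rightarrow> 'a hspace \<Rightarrow> (('a \<Rightarrow> complex) \<Rightarrow> ('a \<Rightarrow> complex)) \<Rightarrow> bool"
  where "cowen_douglas n H T \<longleftrightarrow>
    hilbert_space H \<and> separable_hspace H \<and> bounded_op H H T \<and>
    (\<forall>w\<in>disc. (\<lambda>f. T f - cscale w f) ` hcar H = hcar H) \<and>
    (\<forall>w\<in>disc. cfun.dim (eigenspace H T w) = n) \<and>
    hdense H (cfun.span (\<Union>w\<in>disc. eigenspace H T w))"

text \<open>
  Functions on the disc are extended by \<open>0\<close>, so that they are determined by their values on the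
  disc. The powers are principal; \<open>1 - z * cnj w\<close> has positive real part on the disc.
\<close>

definition kernel_fun :: "real \<Rightarrow> complex \<Rightarrow> complex \<Rightarrow> complex"
  where "kernel_fun l w = (\<lambda>z. if z \<in> disc then (1 - z * cnj w) powr (- of_real l) else 0)"

definition disc_rkhs :: "real \<Rightarrow> complex hspace \<Rightarrow> bool"
  where "disc_rkhs l H \<longleftrightarrow>
    hilbert_space H \<and>
    (\<forall>f\<in>hcar H. f holomorphic_on disc \<and> (\<forall>z. z \<notin> disc \<longrightarrow> f z = 0)) \<and>
    (\<forall>w\<in>disc. kernel_fun l w \<in> hcar H \<and> (\<forall>f\<in>hcar H. f w = inprod H f (kernel_fun l w)))"

text \<open>
  Elements of the direct sum of \<open>n\<close> spaces of functions are functions of a pair: the index of the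
  summand and the point.
\<close>

definition dsum :: "nat \<Rightarrow> (nat \<Rightarrow> 'a hspace) \<Rightarrow> (nat \<times> 'a) hspace"
  where "dsum n H =
    \<lparr> hcar = {F. (\<forall>i<n. (\<lambda>z. F (i, z)) \<in> hcar (H i)) \<and> (\<forall>i\<ge>n. \<forall>z. F (i, z) = 0)},
      inprod = (\<lambda>F G. \<Sum>i<n. inprod (H i) (\<lambda>z. F (i, z)) (\<lambda>z. G (i, z))) \<rparr>"

definition summand :: "nat \<Rightarrow> ('a \<Rightarrow> complex) \<Rightarrow> nat \<times> 'a \<Rightarrow> complex"
  where "summand i f = (\<lambda>(k, z). if k = i then f z else 0)"

text \<open>
  The atom is a holomorphic function of its parameter \<open>w\<close>: it is the kernel function at \<open>cnj w\<close>.
  Derivatives in \<open>w\<close> are taken pointwise in \<open>z\<close>; as point evaluations are continuous, they are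
  the derivatives of the Hilbert-space-valued map.
\<close>

definition atom :: "real \<Rightarrow> complex \<Rightarrow> complex \<Rightarrow> complex"
  where "atom l w = (\<lambda>z. if z \<in> disc then (1 - z * w) powr (- of_real l) else 0)"

definition atom_deriv :: "real \<Rightarrow> nat \<Rightarrow> complex \<Rightarrow> complex \<Rightarrow> complex"
  where "atom_deriv l k w = (\<lambda>z. (deriv ^^ k) (\<lambda>v. atom l v z) w)"

record qh_data =
  lam0 :: real
  valency :: real
  mu :: "nat \<Rightarrow> nat \<Rightarrow> complex"

definition lam :: "qh_data \<Rightarrow> nat \<Rightarrow> real"
  where "lam t i = lam0 t + real i * valency t"

text \<open>
  Below, \<open>A l\<close> stands for the Hilbert space with kernel \<open>(1 - z * cnj w) powr (- l)\<close>, that is,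
  \<open>disc_rkhs l (A l)\<close>.
\<close>

definition ambient :: "(real \<Rightarrow> complex hspace) \<Rightarrow> nat \<Rightarrow> qh_data \<Rightarrow> (nat \<times> complex) hspace"
  where "ambient A n t = dsum n (\<lambda>i. A (lam t i))"

definition frame :: "qh_data \<Rightarrow> nat \<Rightarrow> complex \<Rightarrow> nat \<times> complex \<Rightarrow> complex"
  where "frame t j w = (\<Sum>i\<le>j. cscale (mu t i j) (summand i (atom_deriv (lam t i) (j - i) w)))"

definition qh_curve :: "nat \<Rightarrow> qh_data \<Rightarrow> complex \<Rightarrow> (nat \<times> complex \<Rightarrow> complex) set"
  where "qh_curve n t w = cfun.span ((\<lambda>j. frame t j w) ` {..<n})"

definition atoms_sum_curve :: "nat \<Rightarrow> qh_data \<Rightarrow> complex \<Rightarrow> (nat \<times> complex \<Rightarrow> complex) set"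
  where "atoms_sum_curve n t w = cfun.span ((\<lambda>i. summand i (atom (lam t i) w)) ` {..<n})"

definition quasi_homogeneous :: "(real \<Rightarrow> complex hspace) \<Rightarrow> nat \<Rightarrow> qh_data \<Rightarrow> bool"
  where "quasi_homogeneous A n t \<longleftrightarrow>
    lam0 t > 0 \<and> valency t > 0 \<and>
    (\<forall>i<n. mu t i i = 1) \<and>
    (\<forall>i. i + 1 < n \<longrightarrow> mu t i (i + 1) \<noteq> 0) \<and>
    (\<exists>T. cowen_douglas n (ambient A n t) T \<and>
      (\<forall>w\<in>disc. \<forall>j<n. T (frame t j w) = cscale w (frame t j w)))"

text \<open>The Wirtinger derivatives with respect to \<open>w\<close> and to its conjugate.\<close>

definition wirtinger :: "(complex \<Rightarrow> complex) \<Rightarrow> complex \<Rightarrow> complex"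
  where "wirtinger f w =
    (frechet_derivative f (at w) 1 - \<i> * frechet_derivative f (at w) \<i>) / 2"

definition wirtinger_bar :: "(complex \<Rightarrow> complex) \<Rightarrow> complex \<Rightarrow> complex"
  where "wirtinger_bar f w =
    (frechet_derivative f (at w) 1 + \<i> * frechet_derivative f (at w) \<i>) / 2"

definition atom_sqnorm :: "(real \<Rightarrow> complex hspace) \<Rightarrow> qh_data \<Rightarrow> nat \<Rightarrow> complex \<Rightarrow> real"
  where "atom_sqnorm A t i w = (hnorm (A (lam t i)) (atom (lam t i) w))\<^sup>2"

definition curvature :: "(real \<Rightarrow> complex hspace) \<Rightarrow> qh_data \<Rightarrow> nat \<Rightarrow> complex \<Rightarrow> complex"
  where "curvature A t i w =
    - wirtinger (wirtinger_bar (\<lambda>v. of_real (ln (atom_sqnorm A t i v)))) w"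

text \<open>
  The coefficient of the conjugate differential in the form of index \<open>i, i + 1\<close>. The curvature is
  real and negative on the disc, so the argument of the principal root \<open>csqrt\<close> is a positive real.
\<close>

definition second_ff :: "(real \<Rightarrow> complex hspace) \<Rightarrow> qh_data \<Rightarrow> nat \<Rightarrow> complex \<Rightarrow> complex"
  where "second_ff A t i w =
    mu t i (i + 1) * curvature A t i w /
    csqrt (of_real (atom_sqnorm A t (i + 1) w / atom_sqnorm A t i w)
           - of_real ((cmod (mu t i (i + 1)))\<^sup>2) * curvature A t i w)"

end

theory Submission
  imports Defs "HOL-Complex_Analysis.Complex_Analysis" "HOL-Real_Asymp.Real_Asymp"
begin

text \<open>
  Everything is read off from the monomial basis. In the space with kernel
  \<open>(1 - z * cnj w) powr (- l)\<close> the monomials are orthogonal and \<open>z ^ k\<close> has squared norm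
  \<open>1 / kcoef l k\<close>, where \<open>kcoef l k = pochhammer l k / fact k\<close> grows like \<open>k powr (l - 1)\<close>
  (\<open>parseval\<close>, \<open>riesz_fischer\<close>, \<open>kcoef_asymptotics\<close>). With \<open>f k = kcoef l k * z ^ k\<close> the atom at
  \<open>w\<close> is the sum of the \<open>w ^ k * f k\<close>, so the map that carries each atom of parameter
  \<open>l + m * V\<close>, where \<open>V\<close> is the valency, to the derivative of order \<open>m\<close> of the atom of parameter
  \<open>l\<close> is a weighted shift by \<open>m\<close> places, whose weights have size \<open>k powr (m * (1 - V / 2))\<close> in
  orthonormal bases. For \<open>m > 0\<close> it is bounded if and only if \<open>V \<ge> 2\<close>, and this is the dichotomy of the
  theorem.

  If \<open>V \<ge> 2\<close>, these shifts, weighted by the constants \<open>mu i j\<close> with \<open>i < j\<close>, form a bounded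
  strictly upper triangular block operator \<open>N\<close>. It is nilpotent, so \<open>1 + N\<close> is invertible; and
  \<open>1 + N\<close> takes the atoms to the frame (\<open>atoms_sum_similar\<close>).

  Let \<open>V < 2\<close>. The second fundamental forms determine \<open>lam0\<close> and the constants \<open>mu i (i + 1)\<close>
  (\<open>second_ff_determines\<close>), so both curves live in the same space, and equal curves are similar
  through the identity. Conversely let \<open>X\<close> be bounded and injective and map one curve to the other.
  Then \<open>X\<close> applied to a frame vector at \<open>w\<close> is a combination of the second frame at \<open>w\<close> with
  coefficients that are power series in \<open>w\<close>; comparing the coefficients of \<open>w ^ q\<close> and \<open>z ^ p\<close> gives
  a recurrence for the matrix entries of \<open>X\<close> (\<open>frame_entry_recurrence\<close>). Together with the bound
  that continuity of \<open>X\<close> puts on its entries, it makes \<open>X\<close> block upper triangular, because the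
  parameters increase (\<open>entry_lower_zero\<close>). The part of the recurrence in which the degrees of the
  two sides match then reads
  \<open>mu i j * c i + (terms in off-diagonal entries) = mu' i j * c j\<close>, where \<open>c i\<close> is the leading
  entry of the diagonal block \<open>i\<close>. As \<open>V < 2\<close>, the bound makes the off-diagonal terms tend to \<open>0\<close>
  as \<open>q\<close> grows, so \<open>mu i j * c i = mu' i j * c j\<close> (\<open>mu_intertwining\<close>). For \<open>j = i + 1\<close> the two
  constants agree and are nonzero, so all \<open>c i\<close> are equal; they are nonzero by injectivity, and
  hence \<open>mu = mu'\<close>.
\<close>

section \<open>Hilbert spaces of functions\<close>

lemma sum_fun_apply: "(\<Sum>i\<in>I. f i) x = (\<Sum>i\<in>I. f i x)"
  for f :: "'i \<Rightarrow> 'a \<Rightarrow> 'b::comm_monoid_add"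
  by (induction I rule: infinite_finite_induct) auto

lemma cscale_apply: "cscale c f x = c * f x"
  by (simp add: cscale_def)

context
  fixes H :: "'a hspace"
  assumes H: "hilbert_space H"
begin

lemma hcar_subspace: "cfun.subspace (hcar H)"
  using H by (simp add: hilbert_space_def)

lemmas hcar_0 = cfun.subspace_0[OF hcar_subspace]
  and hcar_add = cfun.subspace_add[OF hcar_subspace]
  and hcar_diff = cfun.subspace_diff[OF hcar_subspace]
  and hcar_cscale = cfun.subspace_scale[OF hcar_subspace]
  and hcar_sum = cfun.subspace_sum[OF hcar_subspace]

lemma inprod_add_left:
    "f \<in> hcar H \<Longrightarrow> g \<in> hcar H \<Longrightarrow> h \<in> hcar H \<Longrightarrow> inprod H (f + g) h = inprod H f h + inprod H g h"
  and inprod_scale_left: "f \<in> hcar H \<Longrightarrow> h \<in> hcar H \<Longrightarrow> inprod H (cscale c f) h = c * inprod H f h"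
  and inprod_cnj: "f \<in> hcar H \<Longrightarrow> g \<in> hcar H \<Longrightarrow> inprod H g f = cnj (inprod H f g)"
  and inprod_pos: "f \<in> hcar H \<Longrightarrow> f \<noteq> 0 \<Longrightarrow> Re (inprod H f f) > 0"
  using H unfolding hilbert_space_def by blast+

lemma hcomplete:
  assumes "\<And>k. F k \<in> hcar H"
    and "\<And>e. e > 0 \<Longrightarrow> \<exists>N. \<forall>k\<ge>N. \<forall>m\<ge>N. hnorm H (F k - F m) < e"
  obtains f where "f \<in> hcar H" "(\<lambda>k::nat. hnorm H (F k - f)) \<longlonglongrightarrow> 0"
  using H assms unfolding hilbert_space_def by blast

lemma inprod_add_right:
  "f \<in> hcar H \<Longrightarrow> g \<in> hcar H \<Longrightarrow> h \<in> hcar H \<Longrightarrow> inprod H h (f + g) = inprod H h f + inprod H h g"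
  using inprod_cnj[of "f + g" h] inprod_cnj[of f h] inprod_cnj[of g h]
  by (simp add: inprod_add_left hcar_add)

lemma inprod_scale_right:
  "f \<in> hcar H \<Longrightarrow> h \<in> hcar H \<Longrightarrow> inprod H h (cscale c f) = cnj c * inprod H h f"
  using inprod_cnj[of "cscale c f" h] inprod_cnj[of f h]
  by (simp add: inprod_scale_left hcar_cscale)

lemma inprod_0_left: "h \<in> hcar H \<Longrightarrow> inprod H 0 h = 0"
  using inprod_add_left[of 0 0 h] hcar_0 by simp

lemma inprod_0_right: "h \<in> hcar H \<Longrightarrow> inprod H h 0 = 0"
  using inprod_add_right[of 0 0 h] hcar_0 by simp

lemma inprod_diff_left:
  "f \<in> hcar H \<Longrightarrow> g \<in> hcar H \<Longrightarrow> h \<in> hcar H \<Longrightarrow> inprod H (f - g) h = inprod H f h - inprod H g h"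
  using inprod_add_left[of "f - g" g h] hcar_diff[of f g] by simp

lemma inprod_diff_right:
  "f \<in> hcar H \<Longrightarrow> g \<in> hcar H \<Longrightarrow> h \<in> hcar H \<Longrightarrow> inprod H h (f - g) = inprod H h f - inprod H h g"
  using inprod_add_right[of "f - g" g h] hcar_diff[of f g] by simp

lemma inprod_sum_right:
  "(\<And>i. i \<in> I \<Longrightarrow> F i \<in> hcar H) \<Longrightarrow> h \<in> hcar H \<Longrightarrow>
    inprod H h (\<Sum>i\<in>I. F i) = (\<Sum>i\<in>I. inprod H h (F i))"
  by (induction I rule: infinite_finite_induct)
     (simp_all add: inprod_0_right inprod_add_right hcar_sum)

lemma inprod_self_nonneg: "f \<in> hcar H \<Longrightarrow> Re (inprod H f f) \<ge> 0"
  using inprod_pos[of f] inprod_0_left[of 0] hcar_0 by (cases "f = 0") auto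

lemma hnorm_nonneg: "f \<in> hcar H \<Longrightarrow> hnorm H f \<ge> 0"
  by (simp add: hnorm_def inprod_self_nonneg)

lemma hnorm_power2: "f \<in> hcar H \<Longrightarrow> (hnorm H f)\<^sup>2 = Re (inprod H f f)"
  by (simp add: hnorm_def inprod_self_nonneg)

lemma inprod_self:
  assumes f: "f \<in> hcar H"
  shows "inprod H f f = of_real ((hnorm H f)\<^sup>2)"
proof -
  have "Im (inprod H f f) = - Im (inprod H f f)"
    using arg_cong[OF inprod_cnj[OF f f], of Im] by simp
  then show ?thesis
    by (simp add: hnorm_power2 f complex_eq_iff del: of_real_power)
qed

lemma hnorm_0: "hnorm H 0 = 0"
  by (simp add: hnorm_def inprod_0_left hcar_0)

lemma hnorm_eq_0: "f \<in> hcar H \<Longrightarrow> hnorm H f = 0 \<Longrightarrow> f = 0"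
  using inprod_pos[of f] hnorm_power2[of f] by fastforce

lemma hnorm_cscale: "f \<in> hcar H \<Longrightarrow> hnorm H (cscale c f) = cmod c * hnorm H f"
proof -
  assume f: "f \<in> hcar H"
  have "inprod H (cscale c f) (cscale c f) = of_real ((cmod c * hnorm H f)\<^sup>2)"
  proof -
    have "inprod H (cscale c f) (cscale c f) = (c * cnj c) * inprod H f f"
      using f by (simp add: inprod_scale_left inprod_scale_right hcar_cscale)
    also have "c * cnj c = of_real ((cmod c)\<^sup>2)"
      by (simp only: complex_norm_square)
    finally show ?thesis
      using f by (simp only: inprod_self power_mult_distrib of_real_mult)
  qed
  then have "(hnorm H (cscale c f))\<^sup>2 = (cmod c * hnorm H f)\<^sup>2"
    using f by (simp only: hnorm_power2[OF hcar_cscale[OF f]] Re_complex_of_real)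
  then show ?thesis
    using f by (simp add: hnorm_nonneg hcar_cscale power2_eq_iff_nonneg)
qed

lemma hnorm_diff_power2:
  "f \<in> hcar H \<Longrightarrow> g \<in> hcar H \<Longrightarrow>
    (hnorm H (f - g))\<^sup>2 = (hnorm H f)\<^sup>2 + (hnorm H g)\<^sup>2 - 2 * Re (inprod H f g)"
  using inprod_cnj[of f g]
  by (simp add: hnorm_power2 hcar_diff inprod_diff_left inprod_diff_right)

lemma hnorm_add_power2:
  "f \<in> hcar H \<Longrightarrow> g \<in> hcar H \<Longrightarrow>
    (hnorm H (f + g))\<^sup>2 = (hnorm H f)\<^sup>2 + (hnorm H g)\<^sup>2 + 2 * Re (inprod H f g)"
  using inprod_cnj[of f g]
  by (simp add: hnorm_power2 hcar_add inprod_add_left inprod_add_right)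

text \<open>
  The square of the norm of \<open>f - c * g\<close> is nonnegative for the orthogonal projection \<open>c * g\<close> of
  \<open>f\<close>.
\<close>

lemma cauchy_schwarz:
  assumes f: "f \<in> hcar H" and g: "g \<in> hcar H"
  shows "cmod (inprod H f g) \<le> hnorm H f * hnorm H g"
proof (cases "hnorm H g = 0")
  case True
  then show ?thesis using hnorm_eq_0[OF g] inprod_0_right[OF f] by simp
next
  case False
  define b where "b = hnorm H g"
  have b: "b > 0" using False hnorm_nonneg[OF g] by (simp add: b_def)
  define c where "c = inprod H f g / of_real (b\<^sup>2)"
  have cg: "cscale c g \<in> hcar H" by (rule hcar_cscale[OF g])
  have cm: "cmod c = cmod (inprod H f g) / b\<^sup>2"
    by (simp add: c_def norm_divide norm_power)
  have "cnj c * inprod H f g = of_real ((cmod (inprod H f g))\<^sup>2 / b\<^sup>2)"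
    by (simp only: c_def complex_cnj_divide complex_cnj_complex_of_real of_real_divide
        complex_norm_square times_divide_eq_left times_divide_eq_right mult.commute)
  then have "Re (cnj c * inprod H f g) = (cmod (inprod H f g))\<^sup>2 / b\<^sup>2"
    by (simp only: Re_complex_of_real)
  then have "(hnorm H (f - cscale c g))\<^sup>2 =
      (hnorm H f)\<^sup>2 + (cmod c * b)\<^sup>2 - 2 * ((cmod (inprod H f g))\<^sup>2 / b\<^sup>2)"
    by (simp only: hnorm_diff_power2[OF f cg] hnorm_cscale[OF g] inprod_scale_right[OF g f] b_def)
  also have "(cmod c * b)\<^sup>2 = (cmod (inprod H f g))\<^sup>2 / b\<^sup>2"
    using b by (simp add: cm field_simps power2_eq_square)
  finally have "(cmod (inprod H f g))\<^sup>2 / b\<^sup>2 \<le> (hnorm H f)\<^sup>2"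
    using zero_le_power2[of "hnorm H (f - cscale c g)"] by linarith
  then have "(cmod (inprod H f g))\<^sup>2 \<le> (hnorm H f * b)\<^sup>2"
    using b by (simp add: field_simps power_mult_distrib)
  then show ?thesis
    using b hnorm_nonneg[OF f] power2_le_imp_le unfolding b_def by fastforce
qed

lemma hnorm_triangle:
  assumes f: "f \<in> hcar H" and g: "g \<in> hcar H"
  shows "hnorm H (f + g) \<le> hnorm H f + hnorm H g"
proof -
  have "Re (inprod H f g) \<le> hnorm H f * hnorm H g"
    using cauchy_schwarz[OF f g] complex_Re_le_cmod order_trans by blast
  then have "(hnorm H (f + g))\<^sup>2 \<le> (hnorm H f + hnorm H g)\<^sup>2"
    by (simp add: hnorm_add_power2[OF f g] power2_sum)
  then show ?thesis
    using hnorm_nonneg[OF f] hnorm_nonneg[OF g] power2_le_imp_le by fastforce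
qed

lemma tendsto_inprod_right:
  assumes F: "\<And>k. F k \<in> hcar H" and f: "f \<in> hcar H" and g: "g \<in> hcar H"
    and lim: "(\<lambda>k::nat. hnorm H (F k - f)) \<longlonglongrightarrow> 0"
  shows "(\<lambda>k. inprod H g (F k)) \<longlonglongrightarrow> inprod H g f"
proof -
  have "(\<lambda>k. hnorm H g * hnorm H (F k - f)) \<longlonglongrightarrow> 0"
    using tendsto_mult_left[OF lim, of "hnorm H g"] by simp
  moreover have "norm (inprod H g (F k) - inprod H g f) \<le> hnorm H g * hnorm H (F k - f)" for k
    using cauchy_schwarz[OF g hcar_diff[OF F f]] by (simp add: inprod_diff_right F f g)
  ultimately have "(\<lambda>k. inprod H g (F k) - inprod H g f) \<longlonglongrightarrow> 0"
    by (rule Lim_null_comparison[OF always_eventually[OF allI], rotated])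
  then show ?thesis by (rule LIM_zero_cancel)
qed

lemma tendsto_inprod_left:
  assumes F: "\<And>k. F k \<in> hcar H" and f: "f \<in> hcar H" and g: "g \<in> hcar H"
    and lim: "(\<lambda>k::nat. hnorm H (F k - f)) \<longlonglongrightarrow> 0"
  shows "(\<lambda>k. inprod H (F k) g) \<longlonglongrightarrow> inprod H f g"
proof -
  have "(\<lambda>k. cnj (inprod H g (F k))) \<longlonglongrightarrow> cnj (inprod H g f)"
    by (intro tendsto_cnj tendsto_inprod_right assms)
  moreover have "cnj (inprod H g h) = inprod H h g" if "h \<in> hcar H" for h
    using inprod_cnj[OF g that] by simp
  ultimately show ?thesis
    using F f by simp
qed

end

section \<open>Taylor coefficients on the disc\<close>

definition taylor :: "(complex \<Rightarrow> complex) \<Rightarrow> nat \<Rightarrow> complex"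
  where "taylor f k = (deriv ^^ k) f 0 / fact k"

lemma taylor_sums:
  assumes "f holomorphic_on disc" "z \<in> disc"
  shows "(\<lambda>k. taylor f k * z ^ k) sums f z"
  using holomorphic_power_series[OF assms] by (simp add: taylor_def)

text \<open>
  Convergence on the disc makes the radius of convergence positive, and the coefficients of a
  power series are determined by the germ of its sum at \<open>0\<close>.
\<close>

lemma taylor_unique:
  assumes "\<And>z. z \<in> disc \<Longrightarrow> (\<lambda>k. a k * z ^ k) sums f z"
  shows "taylor f k = a k"
proof -
  have "norm (of_real r :: complex) \<le> fps_conv_radius (Abs_fps a)" if "0 \<le> r" "r < 1" for r :: real
    unfolding fps_conv_radius_def
    using assms[of "of_real r"] that by (intro conv_radius_geI) (auto simp: sums_iff)
  from this[of "1/2"] have "fps_conv_radius (Abs_fps a) > 0"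
    by (auto simp: zero_ereal_def intro: less_le_trans[of _ "ereal (1/2)"])
  moreover have "eventually (\<lambda>z. eval_fps (Abs_fps a) z = f z) (nhds 0)"
  proof (rule eventually_nhds_in_open[THEN eventually_mono])
    show "open disc" "0 \<in> disc" by auto
    show "eval_fps (Abs_fps a) z = f z" if "z \<in> disc" for z
      using assms[OF that] by (simp add: eval_fps_def sums_iff)
  qed
  ultimately have "f has_fps_expansion Abs_fps a"
    by (simp add: has_fps_expansion_def)
  then have "fps_nth (Abs_fps a) k = (deriv ^^ k) f 0 / fact k"
    by (rule fps_nth_fps_expansion)
  then show "taylor f k = a k"
    by (simp add: taylor_def)
qed

lemma taylor_finite:
  assumes "finite I" "\<And>i. i \<in> I \<Longrightarrow> f i holomorphic_on disc"
  shows "taylor (\<lambda>z. \<Sum>i\<in>I. c i * f i z) k = (\<Sum>i\<in>I. c i * taylor (f i) k)"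
proof (rule taylor_unique)
  show "(\<lambda>k. (\<Sum>i\<in>I. c i * taylor (f i) k) * z ^ k) sums (\<Sum>i\<in>I. c i * f i z)"
    if "z \<in> disc" for z
    using sums_sum[of I "\<lambda>i k. c i * (taylor (f i) k * z ^ k)" "\<lambda>i. c i * f i z"]
      sums_mult[OF taylor_sums[OF assms(2) that]]
    by (simp add: sum_distrib_right mult.assoc)
qed

lemma powser_disc_eq:
  assumes "\<And>z. z \<in> disc \<Longrightarrow> (\<lambda>k. a k * z ^ k) sums f z"
    and "\<And>z. z \<in> disc \<Longrightarrow> (\<lambda>k. b k * z ^ k) sums f z"
  shows "a k = b k"
  using taylor_unique[of a f k] taylor_unique[of b f k] assms by simp

lemma powser_shift_sums:
  fixes z :: complex
  assumes "(\<lambda>k. b k * z ^ k) sums s"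
  shows "(\<lambda>k. (if m \<le> k then b (k - m) else 0) * z ^ k) sums (z ^ m * s)"
proof -
  have "(\<lambda>k. z ^ m * (b k * z ^ k)) sums (z ^ m * s)"
    by (rule sums_mult[OF assms])
  then have "(\<lambda>k. (if m \<le> k + m then b (k + m - m) else 0) * z ^ (k + m)) sums (z ^ m * s)"
    by (simp add: power_add mult_ac)
  then show ?thesis
    by (subst (asm) sums_iff_shift) auto
qed

section \<open>The spaces with kernel \<open>(1 - z * cnj w) powr (- l)\<close> in the monomial basis\<close>

definition monomial :: "nat \<Rightarrow> complex \<Rightarrow> complex"
  where "monomial k = (\<lambda>z. if z \<in> disc then z ^ k else 0)"

definition kcoef :: "real \<Rightarrow> nat \<Rightarrow> real"
  where "kcoef l k = pochhammer l k / fact k"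

lemma kcoef_0: "kcoef l 0 = 1"
  by (simp add: kcoef_def)

lemma kcoef_pos: "l > 0 \<Longrightarrow> kcoef l k > 0"
  by (simp add: kcoef_def pochhammer_pos)

lemma cmod_mult_lt_1: "z \<in> disc \<Longrightarrow> w \<in> disc \<Longrightarrow> cmod (z * w) < 1"
  using mult_strict_mono[of "cmod z" 1 "cmod w" 1] by (auto simp: norm_mult)

lemma kernel_sums:
  assumes "z \<in> disc" "w \<in> disc"
  shows "(\<lambda>k. of_real (kcoef l k) * (z * w) ^ k) sums ((1 - z * w) powr (- of_real l))"
proof -
  have "(\<lambda>k. ((- of_real l) gchoose k) * (- (z * w)) ^ k) sums (1 + - (z * w)) powr (- of_real l)"
    using cmod_mult_lt_1[OF assms] by (intro gen_binomial_complex) simp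
  moreover have "((- of_real l) gchoose k) * (- (z * w)) ^ k = of_real (kcoef l k) * (z * w) ^ k" for k
  proof -
    have "(- (z * w)) ^ k = (-1) ^ k * (z * w) ^ k"
      by (metis mult_minus1 power_mult_distrib)
    moreover have "((-1) ^ k * (-1) ^ k :: complex) = 1"
      by (simp flip: power_mult_distrib)
    ultimately show ?thesis
      by (simp add: gbinomial_pochhammer kcoef_def pochhammer_of_real)
  qed
  ultimately show ?thesis by simp
qed

lemma atom_eq_kernel_fun: "atom l w = kernel_fun l (cnj w)"
  by (simp only: atom_def kernel_fun_def complex_cnj_cnj)

lemma taylor_kernel_fun:
  assumes "w \<in> disc"
  shows "taylor (kernel_fun l w) k = of_real (kcoef l k) * cnj w ^ k"
proof (rule taylor_unique)
  show "(\<lambda>k. of_real (kcoef l k) * cnj w ^ k * z ^ k) sums kernel_fun l w z" if "z \<in> disc" for z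
    using kernel_sums[OF that, of "cnj w" l] assms that
    by (simp add: kernel_fun_def power_mult_distrib mult_ac)
qed

context
  fixes l :: real and H :: "complex hspace"
  assumes l: "l > 0" and rkhs: "disc_rkhs l H"
begin

lemma rkhs_hilbert: "hilbert_space H"
  and rkhs_holomorphic: "f \<in> hcar H \<Longrightarrow> f holomorphic_on disc"
  and rkhs_outside: "f \<in> hcar H \<Longrightarrow> z \<notin> disc \<Longrightarrow> f z = 0"
  and rkhs_kernel: "w \<in> disc \<Longrightarrow> kernel_fun l w \<in> hcar H"
  and rkhs_reproducing: "w \<in> disc \<Longrightarrow> f \<in> hcar H \<Longrightarrow> f w = inprod H f (kernel_fun l w)"
  using rkhs unfolding disc_rkhs_def by blast+

lemma rkhs_eqI:
  assumes "f \<in> hcar H" "g \<in> hcar H" "\<And>k. taylor f k = taylor g k"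
  shows "f = g"
proof
  fix z
  show "f z = g z"
  proof (cases "z \<in> disc")
    case True
    then show ?thesis
      using taylor_sums[OF rkhs_holomorphic[OF assms(1)] True]
        taylor_sums[OF rkhs_holomorphic[OF assms(2)] True] assms(3) sums_unique2 by simp
  next
    case False
    then show ?thesis using rkhs_outside[OF assms(1)] rkhs_outside[OF assms(2)] by simp
  qed
qed

text \<open>
  Neither the monomials nor the Taylor coefficients occur in the definition of the space, which
  speaks of kernel functions only. They are reached by divided differences: take the kernel
  function at a small real point \<open>w m\<close>, remove its first \<open>k\<close> terms and divide by \<open>w m ^ k\<close>. The
  inner product of \<open>f\<close> with the result \<open>R m\<close> is the power series with coefficients
  \<open>taylor f (j + k)\<close> at \<open>w m\<close>. Applied to the \<open>R m\<close> themselves this shows that they form a Cauchy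
  sequence; the limit is \<open>kcoef l k\<close> times the monomial of degree \<open>k\<close>, and the inner product with
  it is the coefficient of index \<open>k\<close>.
\<close>

lemma monomial_step:
  assumes IH: "\<And>j. j < k \<Longrightarrow> monomial j \<in> hcar H"
    "\<And>j f. j < k \<Longrightarrow> f \<in> hcar H \<Longrightarrow> taylor f j = kcoef l j * inprod H f (monomial j)"
  shows "monomial k \<in> hcar H \<and> (\<forall>f\<in>hcar H. taylor f k = kcoef l k * inprod H f (monomial k))"
proof -
  note HS = rkhs_hilbert
  define w :: "nat \<Rightarrow> real" where "w m = inverse (real (m + 2))" for m
  have w: "0 < w m" "w m < 1" for m
    by (auto simp: w_def field_simps)
  have wd: "of_real (w m) \<in> disc" for m
    using w[of m] by (simp add: less_imp_le)
  have w0: "w \<longlonglongrightarrow> 0"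
    unfolding w_def by real_asymp
  define R where "R m = cscale (of_real (1 / w m ^ k))
    (kernel_fun l (of_real (w m)) - (\<Sum>j<k. cscale (of_real (kcoef l j * w m ^ j)) (monomial j)))" for m
  have sumcar: "(\<Sum>j<k. cscale (of_real (kcoef l j * w m ^ j)) (monomial j)) \<in> hcar H" for m
    by (intro hcar_sum[OF HS] hcar_cscale[OF HS]) (use IH in auto)
  have Rcar: "R m \<in> hcar H" for m
    unfolding R_def by (intro hcar_cscale[OF HS] hcar_diff[OF HS] rkhs_kernel wd sumcar)
  have inR: "inprod H f (R m) = (\<Sum>j. taylor f (j + k) * of_real (w m) ^ j)"
    and suR: "summable (\<lambda>j. taylor f (j + k) * of_real (w m) ^ j)"
    if f: "f \<in> hcar H" for f m
  proof -
    have S: "(\<lambda>j. taylor f j * of_real (w m) ^ j) sums f (of_real (w m))"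
      by (rule taylor_sums[OF rkhs_holomorphic[OF f] wd])
    have "(\<lambda>j. taylor f (j + k) * of_real (w m) ^ (j + k)) sums
        (f (of_real (w m)) - (\<Sum>j<k. taylor f j * of_real (w m) ^ j))"
      using S by (subst sums_iff_shift) simp
    then have "(\<lambda>j. of_real (1 / w m ^ k) * (taylor f (j + k) * of_real (w m) ^ (j + k))) sums
        (of_real (1 / w m ^ k) * (f (of_real (w m)) - (\<Sum>j<k. taylor f j * of_real (w m) ^ j)))"
      by (rule sums_mult)
    moreover have "of_real (1 / w m ^ k) * (taylor f (j + k) * of_real (w m) ^ (j + k)) =
        taylor f (j + k) * of_real (w m) ^ j" for j
      using w[of m] by (simp add: power_add)
    moreover have "of_real (1 / w m ^ k) * (f (of_real (w m)) - (\<Sum>j<k. taylor f j * of_real (w m) ^ j))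
       = inprod H f (R m)"
    proof -
      have "inprod H f (\<Sum>j<k. cscale (of_real (kcoef l j * w m ^ j)) (monomial j)) =
          (\<Sum>j<k. inprod H f (cscale (of_real (kcoef l j * w m ^ j)) (monomial j)))"
        by (intro inprod_sum_right[OF HS _ f] hcar_cscale[OF HS] IH) simp
      also have "\<dots> = (\<Sum>j<k. taylor f j * of_real (w m) ^ j)"
        by (intro sum.cong) (simp_all add: inprod_scale_right[OF HS IH(1) f] IH(2)[OF _ f])
      finally show ?thesis
        unfolding R_def
        by (simp only: inprod_scale_right[OF HS hcar_diff[OF HS rkhs_kernel[OF wd] sumcar] f]
            inprod_diff_right[OF HS rkhs_kernel[OF wd] sumcar f] rkhs_reproducing[OF wd f, symmetric]
            complex_cnj_complex_of_real)
    qed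
    ultimately have "(\<lambda>j. taylor f (j + k) * of_real (w m) ^ j) sums inprod H f (R m)"
      by simp
    then show "inprod H f (R m) = (\<Sum>j. taylor f (j + k) * of_real (w m) ^ j)"
      "summable (\<lambda>j. taylor f (j + k) * of_real (w m) ^ j)"
      by (simp_all add: sums_iff)
  qed
  have inR_lim: "(\<lambda>m. inprod H f (R m)) \<longlonglongrightarrow> taylor f k" if f: "f \<in> hcar H" for f
  proof -
    have "((\<lambda>x. \<Sum>j. taylor f (j + k) * x ^ j) \<longlongrightarrow> taylor f (0 + k)) (at 0)"
    proof (rule powser_limit_0_strong[where s = "w 0"])
      show "0 < w 0" by (rule w)
      fix x :: complex
      assume "norm x < w 0"
      then have "norm x < norm (complex_of_real (w 0))" using w[of 0] by simp
      then have "summable (\<lambda>j. taylor f (j + k) * x ^ j)"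
        by (rule powser_inside[OF suR[OF f]])
      then show "(\<lambda>j. taylor f (j + k) * x ^ j) sums (\<Sum>j. taylor f (j + k) * x ^ j)"
        by (rule summable_sums)
    qed
    moreover have "filterlim (\<lambda>m. complex_of_real (w m)) (at 0) sequentially"
      using w(1) tendsto_of_real[OF w0, where 'a = complex]
      by (auto simp: filterlim_at intro!: always_eventually dest: less_imp_neq[symmetric])
    ultimately have "(\<lambda>m. \<Sum>j. taylor f (j + k) * of_real (w m) ^ j) \<longlonglongrightarrow> taylor f (0 + k)"
      by (rule filterlim_compose)
    then show ?thesis
      by (simp add: inR[OF f])
  qed
  have tayR: "taylor (R m) (j + k) = of_real (kcoef l (j + k) * w m ^ j)" for m j
  proof -
    define b where "b i = (if k \<le> i then of_real (kcoef l i * w m ^ (i - k)) else 0 :: complex)" for i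
    have "(\<lambda>i. b i * z ^ i) sums R m z" if z: "z \<in> disc" for z
    proof -
      have "(\<lambda>i. of_real (kcoef l i) * (z * of_real (w m)) ^ i) sums kernel_fun l (of_real (w m)) z"
        using kernel_sums[OF z wd[of m], of l] z by (simp add: kernel_fun_def)
      then have "(\<lambda>i. of_real (kcoef l (i + k)) * (z * of_real (w m)) ^ (i + k)) sums
          (kernel_fun l (of_real (w m)) z - (\<Sum>i<k. of_real (kcoef l i) * (z * of_real (w m)) ^ i))"
        by (subst sums_iff_shift) simp
      then have "(\<lambda>i. of_real (1 / w m ^ k) * (of_real (kcoef l (i + k)) * (z * of_real (w m)) ^ (i + k))) sums
          (of_real (1 / w m ^ k) * (kernel_fun l (of_real (w m)) z - (\<Sum>i<k. of_real (kcoef l i) * (z * of_real (w m)) ^ i)))"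
        by (rule sums_mult)
      moreover have "of_real (1 / w m ^ k) * (of_real (kcoef l (i + k)) * (z * of_real (w m)) ^ (i + k)) = b (i + k) * z ^ (i + k)" for i
        using w[of m] by (simp add: b_def power_add power_mult_distrib)
      moreover have "of_real (1 / w m ^ k) * (kernel_fun l (of_real (w m)) z - (\<Sum>i<k. of_real (kcoef l i) * (z * of_real (w m)) ^ i)) = R m z"
        using z by (simp add: R_def cscale_apply sum_fun_apply monomial_def power_mult_distrib mult_ac)
      ultimately have "(\<lambda>i. b (i + k) * z ^ (i + k)) sums R m z" by simp
      moreover have "(\<Sum>i<k. b i * z ^ i) = 0" by (simp add: b_def)
      ultimately show ?thesis by (subst (asm) sums_iff_shift) simp
    qed
    then have "taylor (R m) (j + k) = b (j + k)"
      by (rule taylor_unique)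
    then show ?thesis by (simp add: b_def)
  qed
  \<comment> \<open>All inner products of the \<open>R m\<close> are values of one function that is continuous at \<open>0\<close>.\<close>
  define S where "S x = (\<Sum>j. of_real (kcoef l (j + k)) * x ^ j)" for x :: complex
  have inRR: "inprod H (R m) (R m') = S (of_real (w m * w m'))" for m m'
    by (simp add: inR[OF Rcar] tayR S_def power_mult_distrib mult.assoc)
  have "(S \<longlongrightarrow> of_real (kcoef l (0 + k))) (at 0)"
  proof (rule powser_limit_0_strong[where s = "w 0 * w 0"])
    show "0 < w 0 * w 0" using w[of 0] by simp
    fix x :: complex
    assume "norm x < w 0 * w 0"
    then have "norm x < norm (complex_of_real (w 0 * w 0))"
      using w[of 0] by (simp add: norm_mult)
    moreover have "summable (\<lambda>j. of_real (kcoef l (j + k)) * complex_of_real (w 0 * w 0) ^ j)"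
      using suR[OF Rcar[of 0], of 0] by (simp add: tayR power_mult_distrib mult.assoc)
    ultimately have "summable (\<lambda>j. of_real (kcoef l (j + k)) * x ^ j)"
      by (rule powser_inside[rotated])
    then show "(\<lambda>j. of_real (kcoef l (j + k)) * x ^ j) sums S x"
      unfolding S_def by (rule summable_sums)
  qed
  then have Slim: "(S \<longlongrightarrow> of_real (kcoef l k)) (at 0)" by simp
  obtain h where h: "h \<in> hcar H" and lim: "(\<lambda>m. hnorm H (R m - h)) \<longlonglongrightarrow> 0"
  proof (rule hcomplete[OF HS Rcar])
    fix e :: real assume e: "e > 0"
    define a where "a = complex_of_real (kcoef l k)"
    obtain d where d: "d > 0" "\<And>x. x \<noteq> 0 \<Longrightarrow> norm x < d \<Longrightarrow> norm (S x - a) < e\<^sup>2 / 4"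
      using LIM_D[OF Slim, of "e\<^sup>2 / 4"] e by (auto simp: a_def)
    obtain N where N: "\<And>m. m \<ge> N \<Longrightarrow> w m < d"
      using order_tendstoD(2)[OF w0 d(1)] by (auto simp: eventually_sequentially)
    have close: "norm (S (of_real (w m * w m')) - a) < e\<^sup>2 / 4" if "m \<ge> N" for m m'
    proof (rule d(2))
      have "w m * w m' < d"
        using w[of m] w[of m'] N[OF that] mult_left_le[OF less_imp_le[OF w(2)[of m']] less_imp_le[OF w(1)[of m]]]
        by linarith
      then show "norm (complex_of_real (w m * w m')) < d"
        using w[of m] w[of m'] by (simp add: norm_mult)
    qed (use w(1)[of m] w(1)[of m'] in simp)
    have "hnorm H (R m - R m') < e" if "m \<ge> N" "m' \<ge> N" for m m'
    proof -
      have "(hnorm H (R m - R m'))\<^sup>2 = Re (S (of_real (w m * w m)) - a)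
          + Re (S (of_real (w m' * w m')) - a) - 2 * Re (S (of_real (w m * w m')) - a)"
        by (simp add: hnorm_diff_power2[OF HS Rcar Rcar] hnorm_power2[OF HS Rcar] inRR)
      also have "\<dots> < e\<^sup>2"
        using close[OF that(1), of m] close[OF that(2), of m'] close[OF that(1), of m']
          abs_Re_le_cmod[of "S (of_real (w m * w m)) - a"]
          abs_Re_le_cmod[of "S (of_real (w m' * w m')) - a"]
          abs_Re_le_cmod[of "S (of_real (w m * w m')) - a"] by linarith
      finally show ?thesis using e power2_less_imp_less[of _ e] by simp
    qed
    then show "\<exists>N. \<forall>m\<ge>N. \<forall>m'\<ge>N. hnorm H (R m - R m') < e" by blast
  qed
  have inh: "inprod H f h = taylor f k" if "f \<in> hcar H" for f
    using tendsto_inprod_right[OF HS Rcar h that lim] inR_lim[OF that] LIMSEQ_unique by blast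
  \<comment> \<open>Testing the limit against a kernel function evaluates it.\<close>
  have hz: "h z = of_real (kcoef l k) * monomial k z" for z
  proof (cases "z \<in> disc")
    case True
    have "h z = inprod H h (kernel_fun l z)"
      by (rule rkhs_reproducing[OF True h])
    also have "\<dots> = cnj (inprod H (kernel_fun l z) h)"
      by (rule inprod_cnj[OF HS rkhs_kernel[OF True] h])
    also have "\<dots> = of_real (kcoef l k) * z ^ k"
      by (simp add: inh[OF rkhs_kernel[OF True]] taylor_kernel_fun[OF True])
    finally show ?thesis using True by (simp add: monomial_def)
  next
    case False
    then show ?thesis using rkhs_outside[OF h False] by (simp add: monomial_def)
  qed
  have "monomial k = cscale (of_real (1 / kcoef l k)) h"
    using kcoef_pos[OF l, of k] by (simp add: fun_eq_iff cscale_apply hz)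
  then have "monomial k \<in> hcar H"
    using hcar_cscale[OF HS h] by simp
  moreover have "h = cscale (of_real (kcoef l k)) (monomial k)"
    by (simp add: fun_eq_iff cscale_apply hz)
  ultimately show ?thesis
    using inh by (simp add: inprod_scale_right[OF HS])
qed

lemma rkhs_monomial: "monomial k \<in> hcar H"
  and taylor_eq_inprod: "f \<in> hcar H \<Longrightarrow> taylor f k = of_real (kcoef l k) * inprod H f (monomial k)"
proof -
  have "monomial k \<in> hcar H \<and> (\<forall>f\<in>hcar H. taylor f k = of_real (kcoef l k) * inprod H f (monomial k))"
  proof (induction k rule: less_induct)
    case (less k)
    show ?case by (rule monomial_step) (use less.IH in blast)+
  qed
  then show "monomial k \<in> hcar H"
    and "f \<in> hcar H \<Longrightarrow> taylor f k = of_real (kcoef l k) * inprod H f (monomial k)"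
    by blast+
qed

lemma inprod_monomial:
  "f \<in> hcar H \<Longrightarrow> inprod H f (monomial k) = taylor f k / of_real (kcoef l k)"
  using taylor_eq_inprod[of f k] kcoef_pos[OF l, of k] by (simp add: field_simps)

lemma taylor_monomial_sum:
  assumes "finite I"
  shows "taylor (\<Sum>k\<in>I. cscale (b k) (monomial k)) j = (if j \<in> I then b j else 0)"
proof (rule taylor_unique)
  fix z assume z: "z \<in> disc"
  have "(\<lambda>k. if k \<in> I then b k * z ^ k else 0) sums (\<Sum>k\<in>I. b k * z ^ k)"
    by (rule sums_If_finite_set[OF assms])
  moreover have "(if j \<in> I then b j else 0) * z ^ j = (if j \<in> I then b j * z ^ j else 0)" for j
    by simp
  ultimately show "(\<lambda>j. (if j \<in> I then b j else 0) * z ^ j) sums (\<Sum>k\<in>I. cscale (b k) (monomial k)) z"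
    using z by (simp add: sum_fun_apply cscale_apply monomial_def)
qed

lemma monomial_sum_in: "(\<Sum>k\<in>I. cscale (b k) (monomial k)) \<in> hcar H"
  by (intro hcar_sum[OF rkhs_hilbert] hcar_cscale[OF rkhs_hilbert] rkhs_monomial)

lemma inprod_monomial_sum:
  assumes "f \<in> hcar H"
  shows "inprod H f (\<Sum>k\<in>I. cscale (b k) (monomial k)) = (\<Sum>k\<in>I. cnj (b k) * taylor f k / of_real (kcoef l k))"
proof -
  have "inprod H f (\<Sum>k\<in>I. cscale (b k) (monomial k)) = (\<Sum>k\<in>I. inprod H f (cscale (b k) (monomial k)))"
    by (intro inprod_sum_right[OF rkhs_hilbert _ assms] hcar_cscale[OF rkhs_hilbert] rkhs_monomial)
  then show ?thesis
    by (simp add: inprod_scale_right[OF rkhs_hilbert rkhs_monomial assms] inprod_monomial[OF assms])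
qed

lemma hnorm_monomial_sum:
  assumes "finite I"
  shows "(hnorm H (\<Sum>k\<in>I. cscale (b k) (monomial k)))\<^sup>2 = (\<Sum>k\<in>I. (cmod (b k))\<^sup>2 / kcoef l k)"
proof -
  have "cnj c * c / complex_of_real x = of_real ((cmod c)\<^sup>2 / x)" for c x
    by (simp only: of_real_divide complex_norm_square mult.commute)
  then have "inprod H (\<Sum>k\<in>I. cscale (b k) (monomial k)) (\<Sum>k\<in>I. cscale (b k) (monomial k)) =
      of_real (\<Sum>k\<in>I. (cmod (b k))\<^sup>2 / kcoef l k)"
    by (simp only: inprod_monomial_sum[OF monomial_sum_in] taylor_monomial_sum[OF assms] of_real_sum if_True
        cong: sum.cong)
  then show ?thesis
    by (simp only: hnorm_power2[OF rkhs_hilbert monomial_sum_in] Re_complex_of_real)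
qed

lemma hnorm_diff_partial_sum:
  assumes "f \<in> hcar H"
  shows "(hnorm H (f - (\<Sum>k<N. cscale (taylor f k) (monomial k))))\<^sup>2 =
    (hnorm H f)\<^sup>2 - (\<Sum>k<N. (cmod (taylor f k))\<^sup>2 / kcoef l k)"
proof -
  have "cnj c * c / complex_of_real x = of_real ((cmod c)\<^sup>2 / x)" for c x
    by (simp only: of_real_divide complex_norm_square mult.commute)
  then have "inprod H f (\<Sum>k<N. cscale (taylor f k) (monomial k)) =
      of_real (\<Sum>k<N. (cmod (taylor f k))\<^sup>2 / kcoef l k)"
    by (simp only: inprod_monomial_sum[OF assms] of_real_sum)
  then show ?thesis
    by (simp add: hnorm_diff_power2[OF rkhs_hilbert assms monomial_sum_in] hnorm_monomial_sum
        del: of_real_sum)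
qed

lemma summable_taylor:
  assumes "f \<in> hcar H"
  shows "summable (\<lambda>k. (cmod (taylor f k))\<^sup>2 / kcoef l k)"
proof (rule summableI_nonneg_bounded)
  show "0 \<le> (cmod (taylor f k))\<^sup>2 / kcoef l k" for k
    using kcoef_pos[OF l, of k] by simp
  show "(\<Sum>k<N. (cmod (taylor f k))\<^sup>2 / kcoef l k) \<le> (hnorm H f)\<^sup>2" for N
    using hnorm_diff_partial_sum[OF assms, of N]
      zero_le_power2[of "hnorm H (f - (\<Sum>k<N. cscale (taylor f k) (monomial k)))"] by linarith
qed

text \<open>
  The partial sums are Cauchy because the monomials are orthogonal; the limit has the prescribed
  coefficients because these are inner products with monomials.
\<close>

lemma riesz_fischer:
  assumes "summable (\<lambda>k. (cmod (b k))\<^sup>2 / kcoef l k)"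
  obtains f where "f \<in> hcar H" "\<And>k. taylor f k = b k"
    "(\<lambda>N. hnorm H ((\<Sum>k<N. cscale (b k) (monomial k)) - f)) \<longlonglongrightarrow> 0"
proof -
  note HS = rkhs_hilbert
  define s where "s N = (\<Sum>k<N. cscale (b k) (monomial k))" for N
  define p where "p N = (\<Sum>k<N. (cmod (b k))\<^sup>2 / kcoef l k)" for N
  have diff: "(hnorm H (s N - s M))\<^sup>2 = p N - p M" if "M \<le> N" for M N
  proof -
    have sp: "{..<N} = {..<M} \<union> {M..<N}" "{..<M} \<inter> {M..<N} = {}" using that by auto
    have "s N - s M = (\<Sum>k\<in>{M..<N}. cscale (b k) (monomial k))"
      unfolding s_def sp(1) by (subst sum.union_disjoint) (use sp(2) in auto)
    moreover have "p N - p M = (\<Sum>k\<in>{M..<N}. (cmod (b k))\<^sup>2 / kcoef l k)"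
      unfolding p_def sp(1) by (subst sum.union_disjoint) (use sp(2) in auto)
    ultimately show ?thesis by (simp add: hnorm_monomial_sum)
  qed
  have scar: "s N \<in> hcar H" for N
    unfolding s_def by (rule monomial_sum_in)
  have sym: "hnorm H (s N - s M) = hnorm H (s M - s N)" for M N
  proof -
    have "s N - s M = cscale (-1) (s M - s N)" by (simp add: cscale_def fun_eq_iff)
    then show ?thesis using hnorm_cscale[OF HS hcar_diff[OF HS scar[of M] scar[of N]], of "-1"] by simp
  qed
  have "Cauchy p"
    unfolding p_def by (rule LIMSEQ_imp_Cauchy[OF summable_LIMSEQ[OF assms]])
  obtain f where f: "f \<in> hcar H" and lim: "(\<lambda>N. hnorm H (s N - f)) \<longlonglongrightarrow> 0"
  proof (rule hcomplete[OF HS scar])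
    fix e :: real assume e: "e > 0"
    then have "e\<^sup>2 > 0" by simp
    then obtain K where K: "\<And>m n. m \<ge> K \<Longrightarrow> n \<ge> K \<Longrightarrow> \<bar>p m - p n\<bar> < e\<^sup>2"
      using \<open>Cauchy p\<close> unfolding Cauchy_def dist_real_def by meson
    have le: "hnorm H (s N - s M) < e" if "M \<ge> K" "N \<ge> K" "M \<le> N" for M N
    proof (rule power2_less_imp_less)
      show "(hnorm H (s N - s M))\<^sup>2 < e\<^sup>2"
        using K[OF that(2,1)] unfolding diff[OF that(3)] by linarith
    qed (use e in simp)
    have "hnorm H (s N - s M) < e" if "N \<ge> K" "M \<ge> K" for M N
      using le[OF that] le[OF that(2,1)] sym[of M N] by (cases "M \<le> N") auto
    then show "\<exists>K. \<forall>N\<ge>K. \<forall>M\<ge>K. hnorm H (s N - s M) < e" by blast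
  qed
  have "taylor f k = b k" for k
  proof -
    have "(\<lambda>N. inprod H (s N) (monomial k)) \<longlonglongrightarrow> inprod H f (monomial k)"
      by (rule tendsto_inprod_left[OF HS scar f rkhs_monomial lim])
    moreover have "eventually (\<lambda>N. inprod H (s N) (monomial k) = b k / of_real (kcoef l k)) sequentially"
      using eventually_gt_at_top[of k]
      by eventually_elim (simp add: inprod_monomial[OF scar], simp add: s_def taylor_monomial_sum)
    ultimately have "inprod H f (monomial k) = b k / of_real (kcoef l k)"
      by (rule LIMSEQ_unique[OF _ tendsto_eventually])
    then show ?thesis
      using kcoef_pos[OF l, of k] by (simp add: inprod_monomial[OF f])
  qed
  then show thesis
    using that f lim unfolding s_def by blast
qed

text \<open>
  The partial sums have a limit in the space, and two elements with the same Taylor coefficients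
  coincide; so the monomials are complete.
\<close>

lemma taylor_expansion_limit:
  assumes "f \<in> hcar H"
  shows "(\<lambda>N. hnorm H ((\<Sum>k<N. cscale (taylor f k) (monomial k)) - f)) \<longlonglongrightarrow> 0"
proof -
  obtain g where "g \<in> hcar H" "\<And>k. taylor g k = taylor f k"
    and "(\<lambda>N. hnorm H ((\<Sum>k<N. cscale (taylor f k) (monomial k)) - g)) \<longlonglongrightarrow> 0"
    by (rule riesz_fischer[OF summable_taylor[OF assms]], rule that)
  moreover from this have "g = f" by (intro rkhs_eqI assms) auto
  ultimately show ?thesis by simp
qed

lemma parseval:
  assumes f: "f \<in> hcar H"
  shows "(\<lambda>k. (cmod (taylor f k))\<^sup>2 / kcoef l k) sums (hnorm H f)\<^sup>2"
proof -
  note HS = rkhs_hilbert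
  let ?s = "\<lambda>N. \<Sum>k<N. cscale (taylor f k) (monomial k)"
  have "(hnorm H (?s N - f))\<^sup>2 = (hnorm H f)\<^sup>2 - (\<Sum>k<N. (cmod (taylor f k))\<^sup>2 / kcoef l k)" for N
  proof -
    have "?s N - f = cscale (-1) (f - ?s N)" by (simp add: cscale_def fun_eq_iff)
    then have "hnorm H (?s N - f) = hnorm H (f - ?s N)"
      using hnorm_cscale[OF HS hcar_diff[OF HS f monomial_sum_in], of "-1"] by simp
    then show ?thesis by (simp only: hnorm_diff_partial_sum[OF f])
  qed
  moreover have "(\<lambda>N. (hnorm H (?s N - f))\<^sup>2) \<longlonglongrightarrow> 0"
    using tendsto_power[OF taylor_expansion_limit[OF f], of 2] by simp
  ultimately have "(\<lambda>N. (hnorm H f)\<^sup>2 - (\<Sum>k<N. (cmod (taylor f k))\<^sup>2 / kcoef l k)) \<longlonglongrightarrow> 0"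
    by simp
  from tendsto_diff[OF tendsto_const[of "(hnorm H f)\<^sup>2"] this] show ?thesis
    by (simp add: sums_def)
qed

lemma taylor_bound:
  assumes "f \<in> hcar H"
  shows "cmod (taylor f k) \<le> sqrt (kcoef l k) * hnorm H f"
proof -
  have "(\<Sum>j\<in>{k}. (cmod (taylor f j))\<^sup>2 / kcoef l j) \<le> (\<Sum>j. (cmod (taylor f j))\<^sup>2 / kcoef l j)"
    using kcoef_pos[OF l] by (intro sum_le_suminf summable_taylor[OF assms]) (auto simp: less_imp_le)
  then have "(cmod (taylor f k))\<^sup>2 / kcoef l k \<le> (hnorm H f)\<^sup>2"
    using sums_unique[OF parseval[OF assms]] by simp
  then have "(cmod (taylor f k))\<^sup>2 \<le> (sqrt (kcoef l k) * hnorm H f)\<^sup>2"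
    using kcoef_pos[OF l, of k] by (simp add: field_simps power_mult_distrib)
  moreover have "sqrt (kcoef l k) * hnorm H f \<ge> 0"
    using kcoef_pos[OF l, of k] hnorm_nonneg[OF rkhs_hilbert assms] by simp
  ultimately show ?thesis by (rule power2_le_imp_le)
qed

lemma hnorm_monomial: "(hnorm H (monomial k))\<^sup>2 = 1 / kcoef l k"
proof -
  have "(\<Sum>k\<in>{k}. cscale 1 (monomial k)) = monomial k" by (simp add: cscale_def)
  then show ?thesis using hnorm_monomial_sum[of "{k}" "\<lambda>_. 1"] by simp
qed

end

section \<open>Bounded operators\<close>

lemma bounded_op_in: "bounded_op H H' X \<Longrightarrow> f \<in> hcar H \<Longrightarrow> X f \<in> hcar H'"
  and bounded_op_add: "bounded_op H H' X \<Longrightarrow> f \<in> hcar H \<Longrightarrow> g \<in> hcar H \<Longrightarrow> X (f + g) = X f + X g"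
  and bounded_op_cscale: "bounded_op H H' X \<Longrightarrow> f \<in> hcar H \<Longrightarrow> X (cscale c f) = cscale c (X f)"
  unfolding bounded_op_def by blast+

text \<open>
  The constant in the definition may be negative when the space is trivial.
\<close>

lemma bounded_op_bound:
  assumes "hilbert_space H" "bounded_op H H' X"
  obtains C where "C \<ge> 0" "\<And>f. f \<in> hcar H \<Longrightarrow> hnorm H' (X f) \<le> C * hnorm H f"
proof -
  obtain C where C: "\<And>f. f \<in> hcar H \<Longrightarrow> hnorm H' (X f) \<le> C * hnorm H f"
    using assms(2) unfolding bounded_op_def by blast
  show thesis
  proof (rule that[of "\<bar>C\<bar>"])
    fix f assume f: "f \<in> hcar H"
    have "C * hnorm H f \<le> \<bar>C\<bar> * hnorm H f"
      using hnorm_nonneg[OF assms(1) f] by (intro mult_right_mono) auto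
    then show "hnorm H' (X f) \<le> \<bar>C\<bar> * hnorm H f" using C[OF f] by linarith
  qed simp
qed

lemma bounded_op_0: "hilbert_space H \<Longrightarrow> bounded_op H H' X \<Longrightarrow> X 0 = 0"
  using bounded_op_add[of H H' X 0 0] hcar_0[of H] by simp

lemma bounded_op_sum:
  assumes "hilbert_space H" "bounded_op H H' X" "\<And>i. i \<in> I \<Longrightarrow> F i \<in> hcar H"
  shows "X (\<Sum>i\<in>I. F i) = (\<Sum>i\<in>I. X (F i))"
  using assms(3)
  by (induction I rule: infinite_finite_induct)
     (simp_all add: bounded_op_0[OF assms(1,2)] bounded_op_add[OF assms(2)] hcar_sum[OF assms(1)])

lemma bounded_op_image_span:
  assumes H: "hilbert_space H" and X: "bounded_op H H' X" and S: "S \<subseteq> hcar H"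
  shows "X ` cfun.span S = cfun.span (X ` S)"
proof
  have sub: "cfun.span S \<subseteq> hcar H"
    by (rule cfun.span_minimal[OF S hcar_subspace[OF H]])
  have "cfun.subspace {f \<in> hcar H. X f \<in> cfun.span (X ` S)}"
    by (intro cfun.subspaceI)
       (auto simp: hcar_0[OF H] hcar_add[OF H] hcar_cscale[OF H] bounded_op_0[OF H X]
         bounded_op_add[OF X] bounded_op_cscale[OF X] cfun.span_zero cfun.span_add cfun.span_scale
         simp del: zero_fun_apply)
  moreover have "S \<subseteq> {f \<in> hcar H. X f \<in> cfun.span (X ` S)}"
    using S by (auto simp: cfun.span_base)
  ultimately have "cfun.span S \<subseteq> {f \<in> hcar H. X f \<in> cfun.span (X ` S)}"
    by (intro cfun.span_minimal)
  then show "X ` cfun.span S \<subseteq> cfun.span (X ` S)" by blast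
  have "cfun.subspace (X ` cfun.span S)"
  proof (rule cfun.subspaceI)
    show "0 \<in> X ` cfun.span S"
      by (rule image_eqI[of _ _ 0]) (simp_all add: bounded_op_0[OF H X] cfun.span_zero)
  next
    fix x y assume "x \<in> X ` cfun.span S" "y \<in> X ` cfun.span S"
    then obtain f g where fg: "f \<in> cfun.span S" "x = X f" "g \<in> cfun.span S" "y = X g" by blast
    then have "x + y = X (f + g)"
      using bounded_op_add[OF X, of f g] sub by (simp add: subset_iff)
    then show "x + y \<in> X ` cfun.span S"
      using cfun.span_add[OF fg(1,3)] by blast
  next
    fix c x assume "x \<in> X ` cfun.span S"
    then obtain f where f: "f \<in> cfun.span S" "x = X f" by blast
    then have "cscale c x = X (cscale c f)"
      using bounded_op_cscale[OF X, of f c] sub by (simp add: subset_iff)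
    then show "cscale c x \<in> X ` cfun.span S"
      using cfun.span_scale[OF f(1), of c] by blast
  qed
  moreover have "X ` S \<subseteq> X ` cfun.span S"
    using cfun.span_superset by (rule image_mono)
  ultimately show "cfun.span (X ` S) \<subseteq> X ` cfun.span S"
    by (intro cfun.span_minimal)
qed

lemma bounded_op_id: "bounded_op H H (\<lambda>f. f)"
  unfolding bounded_op_def by (auto intro!: exI[of _ 1])

lemma bounded_op_zero:
  assumes "hilbert_space H'"
  shows "bounded_op H H' (\<lambda>f. 0)"
  unfolding bounded_op_def
  by (auto intro!: exI[of _ 0] simp: hcar_0[OF assms] hnorm_0[OF assms] cscale_def fun_eq_iff)

lemma bounded_op_compose:
  assumes "hilbert_space H'" "bounded_op H H' X" "bounded_op H' H'' Y"
  shows "bounded_op H H'' (\<lambda>f. Y (X f))"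
proof -
  obtain C where C: "\<And>f. f \<in> hcar H \<Longrightarrow> hnorm H' (X f) \<le> C * hnorm H f"
    using assms(2) unfolding bounded_op_def by blast
  obtain D where D: "D \<ge> 0" "\<And>f. f \<in> hcar H' \<Longrightarrow> hnorm H'' (Y f) \<le> D * hnorm H' f"
    using bounded_op_bound[OF assms(1,3)] by blast
  have "hnorm H'' (Y (X f)) \<le> (D * C) * hnorm H f" if "f \<in> hcar H" for f
    using D(2)[OF bounded_op_in[OF assms(2) that]] mult_left_mono[OF C[OF that] D(1)]
    by (simp add: mult.assoc)
  then show ?thesis
    unfolding bounded_op_def
    by (auto simp: bounded_op_in[OF assms(2)] bounded_op_in[OF assms(3)] bounded_op_add[OF assms(2)]
        bounded_op_add[OF assms(3)] bounded_op_cscale[OF assms(2)] bounded_op_cscale[OF assms(3)])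
qed

lemma bounded_op_plus:
  assumes "hilbert_space H" "hilbert_space H'" "bounded_op H H' X" "bounded_op H H' Y"
  shows "bounded_op H H' (\<lambda>f. X f + Y f)"
proof -
  obtain C where C: "\<And>f. f \<in> hcar H \<Longrightarrow> hnorm H' (X f) \<le> C * hnorm H f"
    using assms(3) unfolding bounded_op_def by blast
  obtain D where D: "\<And>f. f \<in> hcar H \<Longrightarrow> hnorm H' (Y f) \<le> D * hnorm H f"
    using assms(4) unfolding bounded_op_def by blast
  have "hnorm H' (X f + Y f) \<le> (C + D) * hnorm H f" if "f \<in> hcar H" for f
    using hnorm_triangle[OF assms(2) bounded_op_in[OF assms(3) that] bounded_op_in[OF assms(4) that]]
      C[OF that] D[OF that] by (simp add: algebra_simps)
  then have "\<exists>C. \<forall>f\<in>hcar H. hnorm H' (X f + Y f) \<le> C * hnorm H f" by blast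
  then show ?thesis
    unfolding bounded_op_def
    by (simp add: bounded_op_in[OF assms(3)] bounded_op_in[OF assms(4)] bounded_op_add[OF assms(3)]
        bounded_op_add[OF assms(4)] bounded_op_cscale[OF assms(3)] bounded_op_cscale[OF assms(4)]
        hcar_add[OF assms(2)] cfun.scale_right_distrib)
qed

lemma bounded_op_family_sum:
  assumes "hilbert_space H" "hilbert_space H'" "\<And>i. i \<in> I \<Longrightarrow> bounded_op H H' (X i)"
  shows "bounded_op H H' (\<lambda>f. \<Sum>i\<in>I. X i f)"
  using assms(3)
  by (induction I rule: infinite_finite_induct)
     (simp_all add: bounded_op_zero[OF assms(2)] bounded_op_plus[OF assms(1,2)])

lemma bounded_op_scale:
  assumes "hilbert_space H'" "bounded_op H H' X"
  shows "bounded_op H H' (\<lambda>f. cscale c (X f))"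
proof (rule bounded_op_compose[OF assms])
  show "bounded_op H' H' (cscale c)"
    unfolding bounded_op_def
    by (auto simp: hcar_cscale[OF assms(1)] cfun.scale_right_distrib mult.commute
        hnorm_cscale[OF assms(1)] intro!: exI[of _ "cmod c"])
qed

lemma bounded_op_iterate:
  assumes "hilbert_space H" "bounded_op H H N"
  shows "bounded_op H H (N ^^ k)"
proof (induction k)
  case 0
  then show ?case using bounded_op_id by (simp add: id_def)
next
  case (Suc k)
  then show ?case
    using bounded_op_compose[OF assms(1) Suc assms(2)] by (simp add: comp_def)
qed

text \<open>
  The inverse is the Neumann series, which is finite.
\<close>

lemma bounded_invertible_op_unipotent:
  assumes H: "hilbert_space H" and N: "bounded_op H H N"
    and nil: "\<And>f. f \<in> hcar H \<Longrightarrow> (N ^^ n) f = 0"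
  shows "bounded_invertible_op H H (\<lambda>f. f + N f)"
proof -
  define Y where "Y f = (\<Sum>k<n. cscale ((-1) ^ k) ((N ^^ k) f))" for f
  note it = bounded_op_iterate[OF H N]
  have Y: "bounded_op H H Y"
    unfolding Y_def by (intro bounded_op_family_sum[OF H H] bounded_op_scale[OF H] it)
  have tele: "(\<Sum>k<m. cscale ((-1) ^ k) ((N ^^ k) f)) + (\<Sum>k<m. cscale ((-1) ^ k) ((N ^^ Suc k) f))
      = f - cscale ((-1) ^ m) ((N ^^ m) f)" for f m
    by (induction m) (simp_all add: algebra_simps cscale_def fun_eq_iff)
  have sw: "(N ^^ k) (N f) = (N ^^ Suc k) f" for k f
    by (simp add: funpow_swap1)
  have "Y (f + N f) = f" if f: "f \<in> hcar H" for f
  proof -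
    have "Y (f + N f) = Y f + Y (N f)"
      by (rule bounded_op_add[OF Y f bounded_op_in[OF N f]])
    also have "\<dots> = f - cscale ((-1) ^ n) ((N ^^ n) f)"
      unfolding Y_def sw by (rule tele)
    finally show ?thesis by (simp add: nil[OF f])
  qed
  moreover have "Y f + N (Y f) = f" if f: "f \<in> hcar H" for f
  proof -
    have "N (Y f) = (\<Sum>k<n. N (cscale ((-1) ^ k) ((N ^^ k) f)))"
      unfolding Y_def by (intro bounded_op_sum[OF H N] hcar_cscale[OF H] bounded_op_in[OF it f])
    also have "\<dots> = (\<Sum>k<n. cscale ((-1) ^ k) ((N ^^ Suc k) f))"
      by (simp add: bounded_op_cscale[OF N bounded_op_in[OF it f]])
    finally have "Y f + N (Y f) = f - cscale ((-1) ^ n) ((N ^^ n) f)"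
      unfolding Y_def using tele by simp
    then show ?thesis by (simp add: nil[OF f])
  qed
  ultimately show ?thesis
    unfolding bounded_invertible_op_def
    using Y bounded_op_plus[OF H H bounded_op_id N] by blast
qed

section \<open>Direct sums\<close>

definition component :: "nat \<Rightarrow> (nat \<times> 'a \<Rightarrow> complex) \<Rightarrow> 'a \<Rightarrow> complex"
  where "component i F = (\<lambda>z. F (i, z))"

lemma component_add: "component i (F + G) = component i F + component i G"
  and component_cscale: "component i (cscale c F) = cscale c (component i F)"
  and component_zero: "component i 0 = 0"
  and component_sum: "component i (\<Sum>j\<in>J. f j) = (\<Sum>j\<in>J. component i (f j))"
  by (simp_all add: component_def cscale_def fun_eq_iff sum_fun_apply)

lemma component_summand: "component i (summand j f) = (if i = j then f else 0)"
  by (auto simp: component_def summand_def fun_eq_iff)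

lemma summand_add: "summand i (f + g) = summand i f + summand i g"
  and summand_cscale: "summand i (cscale c f) = cscale c (summand i f)"
  and summand_zero: "summand i 0 = 0"
  by (auto simp: summand_def cscale_def fun_eq_iff)

lemma component_eqI: "(\<And>i. component i F = component i G) \<Longrightarrow> F = G"
  by (force simp: component_def fun_eq_iff)

context
  fixes n :: nat and H :: "nat \<Rightarrow> 'a hspace"
  assumes H: "\<And>i. i < n \<Longrightarrow> hilbert_space (H i)"
begin

lemma component_in: "F \<in> hcar (dsum n H) \<Longrightarrow> i < n \<Longrightarrow> component i F \<in> hcar (H i)"
  by (simp add: dsum_def component_def)

lemma component_ge: "F \<in> hcar (dsum n H) \<Longrightarrow> i \<ge> n \<Longrightarrow> component i F = 0"
  by (simp add: dsum_def component_def fun_eq_iff)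

lemma hnorm_dsum:
  assumes "F \<in> hcar (dsum n H)"
  shows "(hnorm (dsum n H) F)\<^sup>2 = (\<Sum>i<n. (hnorm (H i) (component i F))\<^sup>2)"
proof -
  have "Re (inprod (dsum n H) F F) = (\<Sum>i<n. Re (inprod (H i) (component i F) (component i F)))"
    by (simp add: dsum_def component_def)
  also have "\<dots> = (\<Sum>i<n. (hnorm (H i) (component i F))\<^sup>2)"
    using hnorm_power2[OF H component_in[OF assms]] by simp
  finally have eq: "Re (inprod (dsum n H) F F) = (\<Sum>i<n. (hnorm (H i) (component i F))\<^sup>2)" .
  then have "Re (inprod (dsum n H) F F) \<ge> 0" by (simp add: sum_nonneg)
  with eq show ?thesis by (simp add: hnorm_def[of "dsum n H"])
qed

lemma hnorm_dsum_nonneg: "F \<in> hcar (dsum n H) \<Longrightarrow> hnorm (dsum n H) F \<ge> 0"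
proof -
  assume F: "F \<in> hcar (dsum n H)"
  have "Re (inprod (dsum n H) F F) = (\<Sum>i<n. Re (inprod (H i) (component i F) (component i F)))"
    by (simp add: dsum_def component_def)
  also have "\<dots> \<ge> 0"
    using inprod_self_nonneg[OF H component_in[OF F]] by (intro sum_nonneg) simp
  finally show ?thesis by (simp add: hnorm_def)
qed

lemma hnorm_component_le:
  assumes F: "F \<in> hcar (dsum n H)" and i: "i < n"
  shows "hnorm (H i) (component i F) \<le> hnorm (dsum n H) F"
proof (rule power2_le_imp_le)
  have "(hnorm (H i) (component i F))\<^sup>2 \<le> (\<Sum>i<n. (hnorm (H i) (component i F))\<^sup>2)"
    using i by (intro member_le_sum) auto
  then show "(hnorm (H i) (component i F))\<^sup>2 \<le> (hnorm (dsum n H) F)\<^sup>2"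
    by (simp add: hnorm_dsum[OF F])
  show "0 \<le> hnorm (dsum n H) F" by (rule hnorm_dsum_nonneg[OF F])
qed

lemma summand_in:
  assumes "f \<in> hcar (H i)" "i < n"
  shows "summand i f \<in> hcar (dsum n H)"
proof -
  have "(\<lambda>z. summand i f (k, z)) \<in> hcar (H k)" if "k < n" for k
    using component_summand[of k i f] assms hcar_0[OF H[OF that]]
    by (auto simp: component_def split: if_splits)
  then show ?thesis
    using assms(2) by (auto simp: dsum_def summand_def)
qed

lemma hnorm_summand:
  assumes "f \<in> hcar (H i)" "i < n"
  shows "hnorm (dsum n H) (summand i f) = hnorm (H i) f"
proof -
  have "(hnorm (dsum n H) (summand i f))\<^sup>2 = (\<Sum>k<n. if k = i then (hnorm (H i) f)\<^sup>2 else 0)"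
    unfolding hnorm_dsum[OF summand_in[OF assms]]
    by (intro sum.cong) (auto simp: component_summand hnorm_0[OF H])
  also have "\<dots> = (hnorm (H i) f)\<^sup>2" using assms(2) by simp
  finally show ?thesis
    using hnorm_nonneg[OF H[OF assms(2)] assms(1)] hnorm_dsum_nonneg[OF summand_in[OF assms]]
    by (simp add: power2_eq_iff_nonneg)
qed

lemma bounded_op_component: "i < n \<Longrightarrow> bounded_op (dsum n H) (H i) (component i)"
  unfolding bounded_op_def
  by (auto simp: component_in component_add component_cscale hnorm_component_le intro!: exI[of _ 1])

lemma bounded_op_summand: "i < n \<Longrightarrow> bounded_op (H i) (dsum n H) (summand i)"
  unfolding bounded_op_def
  by (auto simp: summand_in hnorm_summand summand_add summand_cscale intro!: exI[of _ 1])

end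

section \<open>Derivatives of the atoms\<close>

lemma one_minus_not_nonpos:
  assumes "z \<in> disc" "w \<in> disc"
  shows "1 - z * w \<notin> \<real>\<^sub>\<le>\<^sub>0"
  using cmod_mult_lt_1[OF assms] complex_Re_le_cmod[of "z * w"]
  by (auto simp: complex_nonpos_Reals_iff)

text \<open>
  The closed form turns the derivatives of an atom into atoms of larger parameter, so that their
  power series come from the binomial series without differentiating term by term.
\<close>

lemma higher_deriv_powr:
  assumes z: "z \<in> disc" and w: "w \<in> disc"
  shows "(deriv ^^ m) (\<lambda>v. (1 - z * v) powr (- s)) w =
    z ^ m * pochhammer s m * (1 - z * w) powr (- s - of_nat m)"
  using w
proof (induction m arbitrary: w)
  case 0
  then show ?case by simp
next
  case (Suc m)
  let ?g = "\<lambda>v. z ^ m * pochhammer s m * (1 - z * v) powr (- s - of_nat m)"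
  have "(deriv ^^ Suc m) (\<lambda>v. (1 - z * v) powr (- s)) w = deriv ((deriv ^^ m) (\<lambda>v. (1 - z * v) powr (- s))) w"
    by simp
  also have "\<dots> = deriv ?g w"
  proof (rule deriv_cong_ev)
    show "eventually (\<lambda>v. (deriv ^^ m) (\<lambda>v. (1 - z * v) powr (- s)) v = ?g v) (nhds w)"
      using Suc by (intro eventually_nhds_in_open[of disc, THEN eventually_mono]) auto
  qed simp
  also have "\<dots> = z ^ m * pochhammer s m * ((- s - of_nat m) * (1 - z * w) powr (- s - of_nat m - 1) * (- z))"
  proof (rule DERIV_imp_deriv, rule DERIV_cmult)
    have "((\<lambda>v. 1 - z * v) has_field_derivative (- z)) (at w)"
      by (auto intro!: derivative_eq_intros)
    then show "((\<lambda>v. (1 - z * v) powr (- s - of_nat m)) has_field_derivative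
        (- s - of_nat m) * (1 - z * w) powr (- s - of_nat m - 1) * (- z)) (at w)"
      by (rule DERIV_chain2[where g = "\<lambda>v. 1 - z * v" and x = w,
          OF has_field_derivative_powr[OF one_minus_not_nonpos[OF z Suc.prems]]])
  qed
  also have "\<dots> = z ^ Suc m * pochhammer s (Suc m) * (1 - z * w) powr (- s - of_nat (Suc m))"
    by (simp add: pochhammer_Suc algebra_simps)
  finally show ?case .
qed

lemma atom_deriv_eq:
  assumes w: "w \<in> disc"
  shows "atom_deriv l m w z = (if z \<in> disc then
    z ^ m * of_real (pochhammer l m) * (1 - z * w) powr (- of_real (l + m)) else 0)"
proof (cases "z \<in> disc")
  case True
  then show ?thesis
    using higher_deriv_powr[OF True w, of m "of_real l"]
    by (simp add: atom_deriv_def atom_def pochhammer_of_real)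
next
  case False
  have "(deriv ^^ m) (\<lambda>v. 0 :: complex) = (\<lambda>v. 0)" by (induction m) simp_all
  then show ?thesis using False by (simp add: atom_deriv_def atom_def)
qed

text \<open>
  The factor that differentiating a power \<open>m\<close> times produces in front of the power \<open>q\<close>.
\<close>

definition rise :: "nat \<Rightarrow> nat \<Rightarrow> real"
  where "rise q m = fact (q + m) / fact q"

lemma rise_0: "rise q 0 = 1"
  by (simp add: rise_def)

lemma rise_pos: "rise q m > 0"
  by (simp add: rise_def)

lemma rise_eq_pochhammer: "rise q m = pochhammer (of_nat (Suc q)) m"
proof -
  have "fact (q + m) = fact q * pochhammer (1 + real q) m"
    using pochhammer_product'[of "1 :: real" q m] by (simp only: pochhammer_fact)
  then show ?thesis by (simp add: rise_def add.commute)
qed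

lemma rise_kcoef: "rise q m * kcoef l (q + m) = pochhammer l m * kcoef (l + m) q"
  using pochhammer_product'[of l m q] by (simp add: rise_def kcoef_def add.commute[of q])

lemma rise_conv_kcoef: "rise q m = fact m * kcoef (1 + m) q"
  using rise_kcoef[of q m 1] by (simp add: kcoef_def flip: pochhammer_fact)

lemma pochhammer_mono:
  fixes x y :: real
  assumes "0 < x" "x \<le> y"
  shows "pochhammer x m \<le> pochhammer y m"
proof (induction m)
  case (Suc m)
  then show ?case
    using assms pochhammer_pos[of x m] pochhammer_pos[of y m]
    by (auto simp: pochhammer_Suc intro!: mult_mono)
qed simp

lemma kcoef_mono: "0 < l \<Longrightarrow> l \<le> l' \<Longrightarrow> kcoef l k \<le> kcoef l' k"
  by (auto simp: kcoef_def intro!: divide_right_mono pochhammer_mono)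

lemma atom_deriv_sums:
  assumes w: "w \<in> disc" and z: "z \<in> disc"
  shows "(\<lambda>k. (if m \<le> k then of_real (rise (k - m) m * kcoef l k) * w ^ (k - m) else 0) * z ^ k)
    sums atom_deriv l m w z"
proof -
  have "(\<lambda>q. of_real (pochhammer l m) * (of_real (kcoef (l + m) q) * (z * w) ^ q)) sums
      (of_real (pochhammer l m) * (1 - z * w) powr (- of_real (l + m)))"
    by (rule sums_mult[OF kernel_sums[OF z w]])
  moreover have "of_real (pochhammer l m) * (of_real (kcoef (l + m) q) * (z * w) ^ q) =
      of_real (rise q m * kcoef l (q + m)) * w ^ q * z ^ q" for q
    by (simp only: rise_kcoef of_real_mult power_mult_distrib mult_ac)
  ultimately have "(\<lambda>q. of_real (rise q m * kcoef l (q + m)) * w ^ q * z ^ q) sums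
      (of_real (pochhammer l m) * (1 - z * w) powr (- of_real (l + m)))"
    by simp
  from powser_shift_sums[OF this, of m] show ?thesis
    using z by (simp add: atom_deriv_eq[OF w] mult_ac cong: if_cong)
qed

lemma taylor_atom_deriv:
  assumes w: "w \<in> disc"
  shows "taylor (atom_deriv l m w) k =
    (if m \<le> k then of_real (rise (k - m) m * kcoef l k) * w ^ (k - m) else 0)"
  by (rule taylor_unique[OF atom_deriv_sums[OF w]])

lemma atom_deriv_0: "atom_deriv l 0 w = atom l w"
  by (simp add: atom_deriv_def)

lemma summable_kcoef:
  assumes "0 \<le> s" "s < 1"
  shows "summable (\<lambda>q. kcoef l q * s ^ q)"
proof -
  have "(\<lambda>q. of_real (kcoef l q) * (of_real s * 1) ^ q) sums ((1 - of_real s * 1) powr (- of_real l :: complex))"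

  proof -
    obtain r where r: "s < r" "r < 1" using dense[OF assms(2)] by blast
    have "of_real (s / r) \<in> disc" "of_real r \<in> disc"
      using r assms by (auto simp: norm_divide)
    from kernel_sums[OF this, of l] show ?thesis
      using r assms by (simp add: field_simps)
  qed
  then have "summable (\<lambda>q. complex_of_real (kcoef l q * s ^ q))"
    using assms by (simp add: sums_iff)
  then show ?thesis by (simp only: summable_complex_of_real)
qed

text \<open>
  By \<open>rise_kcoef\<close> and \<open>rise_conv_kcoef\<close> the squared coefficients, divided by \<open>kcoef\<close>, are
  products of two sequences of the form \<open>kcoef a q * cmod w ^ q\<close>, each of which is summable.
\<close>

lemma atom_deriv_in:
  assumes l: "l > 0" and H: "disc_rkhs l H" and w: "w \<in> disc"
  shows "atom_deriv l m w \<in> hcar H"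
proof -
  define b where "b k = (if m \<le> k then of_real (rise (k - m) m * kcoef l k) * w ^ (k - m) else 0)" for k
  have "summable (\<lambda>q. (cmod (b (q + m)))\<^sup>2 / kcoef l (q + m))"
  proof -
    define s where "s = cmod w"
    have s: "0 \<le> s" "s < 1" using w by (auto simp: s_def)
    define a where "a q = kcoef (l + m) q * s ^ q" for q
    define a' where "a' q = kcoef (1 + m) q * s ^ q" for q
    have eq: "(cmod (b (q + m)))\<^sup>2 / kcoef l (q + m) = (pochhammer l m * fact m) * (a q * a' q)" for q
    proof -
      have k: "kcoef l (q + m) > 0" by (rule kcoef_pos[OF l])
      have "(cmod (b (q + m)))\<^sup>2 / kcoef l (q + m) = rise q m * (rise q m * kcoef l (q + m)) * s ^ q * s ^ q"
        using k rise_pos[of q m]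
        by (simp add: b_def s_def norm_mult norm_power power2_eq_square field_simps)
      also have "rise q m * (rise q m * kcoef l (q + m)) =
          (fact m * kcoef (1 + m) q) * (pochhammer l m * kcoef (l + m) q)"
        unfolding rise_kcoef by (simp only: rise_conv_kcoef)
      finally show ?thesis
        by (simp add: a_def a'_def mult_ac)
    qed
    have "summable a" "summable a'"
      unfolding a_def a'_def by (rule summable_kcoef[OF s])+
    have nn: "a q \<ge> 0" "a' q \<ge> 0" for q
      using kcoef_pos[of "l + m" q] kcoef_pos[of "1 + m" q] l s(1)
      by (auto simp: a_def a'_def less_imp_le)
    have "eventually (\<lambda>q. a q < 1) sequentially"
      using summable_LIMSEQ_zero[OF \<open>summable a\<close>] by (rule order_tendstoD) simp
    then have "eventually (\<lambda>q. norm (a q * a' q) \<le> a' q) sequentially"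
      by eventually_elim (use nn in \<open>auto simp: abs_mult intro!: mult_left_le_one_le\<close>)
    then have "summable (\<lambda>q. a q * a' q)"
      by (rule summable_comparison_test_ev) fact
    then show ?thesis unfolding eq by (rule summable_mult)
  qed
  then have "summable (\<lambda>k. (cmod (b k))\<^sup>2 / kcoef l k)"
    using summable_iff_shift[of "\<lambda>k. (cmod (b k))\<^sup>2 / kcoef l k" m] by blast
  then obtain f where f: "f \<in> hcar H" "\<And>k. taylor f k = b k"
    by (rule riesz_fischer[OF l H]) (rule that)
  have "f z = atom_deriv l m w z" for z
  proof (cases "z \<in> disc")
    case True
    show ?thesis
      using taylor_sums[OF rkhs_holomorphic[OF l H f(1)] True] atom_deriv_sums[OF w True, of m l]
      by (simp add: f(2) b_def sums_unique2 cong: if_cong)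
  next
    case False
    then show ?thesis
      using rkhs_outside[OF l H f(1) False] by (simp add: atom_deriv_eq[OF w])
  qed
  then have "f = atom_deriv l m w" ..
  with f show ?thesis by simp
qed

section \<open>Weighted shifts and differentiation\<close>

lemma taylor_add:
  assumes "f holomorphic_on disc" "g holomorphic_on disc"
  shows "taylor (f + g) k = taylor f k + taylor g k"
proof (rule taylor_unique)
  show "(\<lambda>k. (taylor f k + taylor g k) * z ^ k) sums (f + g) z" if "z \<in> disc" for z
    using sums_add[OF taylor_sums[OF assms(1) that] taylor_sums[OF assms(2) that]]
    by (simp add: distrib_right)
qed

lemma taylor_cscale:
  assumes "f holomorphic_on disc"
  shows "taylor (cscale c f) k = c * taylor f k"
proof (rule taylor_unique)
  show "(\<lambda>k. c * taylor f k * z ^ k) sums cscale c f z" if "z \<in> disc" for z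
    using sums_mult[OF taylor_sums[OF assms that], of c]
    by (simp add: cscale_apply mult.assoc)
qed

text \<open>
  The hypothesis compares the weight with the norms of the monomials of degree \<open>k\<close> and \<open>k + m\<close>,
  so the operator multiplies orthonormal basis vectors by bounded factors.
\<close>

lemma weighted_shift:
  assumes l: "l > 0" "disc_rkhs l H" and l': "l' > 0" "disc_rkhs l' H'"
    and le: "\<And>k. (d k)\<^sup>2 * kcoef l k \<le> C * kcoef l' (k + m)"
  obtains D where "bounded_op H H' D"
    "\<And>f k. f \<in> hcar H \<Longrightarrow> taylor (D f) k = (if m \<le> k then of_real (d (k - m)) * taylor f (k - m) else 0)"
proof -
  define b where "b f k = (if m \<le> k then of_real (d (k - m)) * taylor f (k - m) else 0)" for f k
  have k: "kcoef l q > 0" "kcoef l' q > 0" for q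
    using kcoef_pos l l' by auto
  have C: "C \<ge> 0"
  proof -
    have "0 \<le> (d 0)\<^sup>2 * kcoef l 0" using k(1)[of 0] by simp
    also have "\<dots> \<le> C * kcoef l' (0 + m)" by (rule le)
    finally show ?thesis using k(2)[of m] by (simp add: zero_le_mult_iff)
  qed
  have bnd: "(cmod (b f (q + m)))\<^sup>2 / kcoef l' (q + m) \<le> C * ((cmod (taylor f q))\<^sup>2 / kcoef l q)" for f q
  proof -
    have "(cmod (taylor f q))\<^sup>2 * ((d q)\<^sup>2 * kcoef l q) \<le> (cmod (taylor f q))\<^sup>2 * (C * kcoef l' (q + m))"
      by (intro mult_left_mono le) simp
    then show ?thesis
      using k[of q] k[of "q + m"] by (simp add: b_def norm_mult power_mult_distrib field_simps)
  qed
  have summ: "summable (\<lambda>q. (cmod (b f (q + m)))\<^sup>2 / kcoef l' (q + m))" if "f \<in> hcar H" for f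
  proof (rule summable_comparison_test)
    show "summable (\<lambda>q. C * ((cmod (taylor f q))\<^sup>2 / kcoef l q))"
      by (rule summable_mult[OF summable_taylor[OF l that]])
    show "\<exists>N. \<forall>q\<ge>N. norm ((cmod (b f (q + m)))\<^sup>2 / kcoef l' (q + m)) \<le> C * ((cmod (taylor f q))\<^sup>2 / kcoef l q)"
      using bnd k by (auto simp: less_imp_le)
  qed
  have "\<exists>g. g \<in> hcar H' \<and> (\<forall>k. taylor g k = b f k)" if "f \<in> hcar H" for f
  proof -
    have "summable (\<lambda>k. (cmod (b f k))\<^sup>2 / kcoef l' k)"
      using summ[OF that] by (simp only: summable_iff_shift[of "\<lambda>k. (cmod (b f k))\<^sup>2 / kcoef l' k" m])
    then show ?thesis by (rule riesz_fischer[OF l']) blast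
  qed
  then obtain D where D: "\<And>f. f \<in> hcar H \<Longrightarrow> D f \<in> hcar H'"
    "\<And>f k. f \<in> hcar H \<Longrightarrow> taylor (D f) k = b f k" by metis
  note HS = rkhs_hilbert[OF l] and HS' = rkhs_hilbert[OF l']
  note hol = rkhs_holomorphic[OF l] and hol' = rkhs_holomorphic[OF l']
  have "D (f + g) = D f + D g" if "f \<in> hcar H" "g \<in> hcar H" for f g
    using that by (intro rkhs_eqI[OF l'])
      (simp_all add: D hcar_add[OF HS] hcar_add[OF HS'] taylor_add hol hol' b_def algebra_simps)
  moreover have "D (cscale c f) = cscale c (D f)" if "f \<in> hcar H" for f c
    using that by (intro rkhs_eqI[OF l'])
      (simp_all add: D hcar_cscale[OF HS] hcar_cscale[OF HS'] taylor_cscale hol hol' b_def)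
  moreover have "hnorm H' (D f) \<le> sqrt C * hnorm H f" if f: "f \<in> hcar H" for f
  proof (rule power2_le_imp_le)
    have "(\<lambda>k. (cmod (b f k))\<^sup>2 / kcoef l' k) sums (hnorm H' (D f))\<^sup>2"
      using parseval[OF l' D(1)[OF f]] by (simp add: D(2)[OF f])
    then have "(\<lambda>q. (cmod (b f (q + m)))\<^sup>2 / kcoef l' (q + m)) sums (hnorm H' (D f))\<^sup>2"
      by (subst sums_iff_shift) (simp add: b_def)
    then have "(hnorm H' (D f))\<^sup>2 \<le> C * (hnorm H f)\<^sup>2"
      by (rule sums_le[OF bnd _ sums_mult[OF parseval[OF l f]]])
    then show "(hnorm H' (D f))\<^sup>2 \<le> (sqrt C * hnorm H f)\<^sup>2"
      using C by (simp add: power_mult_distrib)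
    show "0 \<le> sqrt C * hnorm H f" using C hnorm_nonneg[OF HS f] by simp
  qed
  ultimately have "bounded_op H H' D"
    unfolding bounded_op_def using D(1) by blast
  then show thesis using that D(2) by (simp add: b_def)
qed

text \<open>
  For \<open>l' = l + 2 * m\<close>, cancelling common factors leaves \<open>rise k m\<close> on the left and
  \<open>pochhammer (l + k + m) m\<close> on the right, which is larger factor by factor.
\<close>

lemma kcoef_rise_bound:
  assumes l: "l > 0" and m: "m > 0" and l': "l' \<ge> l + 2 * real m"
  shows "(rise k m)\<^sup>2 * kcoef l (k + m) \<le> pochhammer l (2 * m) * kcoef l' k"
proof -
  have "rise k m \<le> pochhammer (l + real (k + m)) m"
    unfolding rise_eq_pochhammer using l m by (intro pochhammer_mono) auto
  then have "rise k m * (rise k m * kcoef l (k + m)) \<le> pochhammer (l + real (k + m)) m * (rise k m * kcoef l (k + m))"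
    using rise_pos[of k m] kcoef_pos[OF l, of "k + m"] by (intro mult_right_mono) auto
  also have "\<dots> = pochhammer l (2 * m) * kcoef (l + real (2 * m)) k"
  proof -
    have "pochhammer l (k + m) * pochhammer (l + real (k + m)) m = pochhammer l (2 * m) * pochhammer (l + real (2 * m)) k"
    proof -
      have "k + m + m = 2 * m + k" by simp
      then show ?thesis by (simp only: pochhammer_product'[symmetric])
    qed
    then show ?thesis
      by (simp add: rise_def kcoef_def field_simps)
  qed
  also have "\<dots> \<le> pochhammer l (2 * m) * kcoef l' k"
    using l l' pochhammer_pos[of l "2 * m"] by (intro mult_left_mono kcoef_mono) auto
  finally show ?thesis by (simp add: power2_eq_square mult.assoc)
qed

text \<open>
  This is the adjoint of differentiating \<open>m\<close> times. Two units of the parameter pay for each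
  derivative, which is why the valency \<open>2\<close> is the threshold.
\<close>

lemma bounded_derivation:
  assumes l: "l > 0" "disc_rkhs l H" and l': "l' > 0" "disc_rkhs l' H'"
    and m: "m > 0" "l' \<ge> l + 2 * real m"
  obtains D where "bounded_op H' H D" "\<And>w. w \<in> disc \<Longrightarrow> D (atom l' w) = atom_deriv l m w"
proof -
  have "(rise k m * kcoef l (k + m) / kcoef l' k)\<^sup>2 * kcoef l' k \<le> pochhammer l (2 * m) * kcoef l (k + m)" for k
  proof -
    have k: "kcoef l' k > 0" "kcoef l (k + m) > 0" using kcoef_pos l l' by auto
    have "((rise k m)\<^sup>2 * kcoef l (k + m)) * kcoef l (k + m) \<le> (pochhammer l (2 * m) * kcoef l' k) * kcoef l (k + m)"
      using k kcoef_rise_bound[OF l(1) m] by (intro mult_right_mono) auto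
    then show ?thesis using k by (simp add: power2_eq_square field_simps)
  qed
  from weighted_shift[OF l' l this] obtain D where D: "bounded_op H' H D"
    "\<And>f k. f \<in> hcar H' \<Longrightarrow> taylor (D f) k = (if m \<le> k then
       of_real (rise (k - m) m * kcoef l (k - m + m) / kcoef l' (k - m)) * taylor f (k - m) else 0)"
    by blast
  show thesis
  proof (rule that[OF D(1)])
    fix w assume w: "w \<in> disc"
    have a: "atom l' w \<in> hcar H'"
      using atom_deriv_in[OF l' w, of 0] by (simp add: atom_deriv_0)
    show "D (atom l' w) = atom_deriv l m w"
    proof (rule rkhs_eqI[OF l bounded_op_in[OF D(1) a] atom_deriv_in[OF l w]])
      fix k
      have "taylor (atom l' w) j = of_real (kcoef l' j) * w ^ j" for j
        using taylor_atom_deriv[OF w, of l' 0 j] by (simp add: atom_deriv_0 rise_0)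
      then show "taylor (D (atom l' w)) k = taylor (atom_deriv l m w) k"
        using kcoef_pos[OF l'(1), of "k - m"] by (simp add: D(2)[OF a] taylor_atom_deriv[OF w])
    qed
  qed
qed

section \<open>Similarity to the sum of the atoms for large valency\<close>

lemma similar_curves_sym:
  assumes sub: "\<And>w. w \<in> disc \<Longrightarrow> s w \<subseteq> hcar H"
    and sim: "similar_curves H s H' s'"
  shows "similar_curves H' s' H s"
proof -
  obtain X Y where X: "bounded_op H H' X" and img: "\<And>w. w \<in> disc \<Longrightarrow> X ` s w = s' w"
    and Y: "bounded_op H' H Y" and inv: "\<And>f. f \<in> hcar H \<Longrightarrow> Y (X f) = f"
      "\<And>g. g \<in> hcar H' \<Longrightarrow> X (Y g) = g"
    using sim unfolding similar_curves_def bounded_invertible_op_def by blast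
  have "Y ` s' w = s w" if w: "w \<in> disc" for w
  proof -
    have "Y ` s' w = (\<lambda>f. Y (X f)) ` s w"
      by (simp only: img[OF w, symmetric] image_image)
    also have "\<dots> = (\<lambda>f. f) ` s w"
      using sub[OF w] inv(1) by (intro image_cong) auto
    finally show ?thesis by simp
  qed
  then show ?thesis
    unfolding similar_curves_def bounded_invertible_op_def using X Y inv by blast
qed

locale qh_setting =
  fixes A :: "real \<Rightarrow> complex hspace" and n :: nat and t :: qh_data
  assumes A: "\<And>l. l > 0 \<Longrightarrow> disc_rkhs l (A l)"
    and qh: "quasi_homogeneous A n t"
begin

lemma lam_pos: "lam t i > 0"
  using qh unfolding quasi_homogeneous_def lam_def by (simp add: add_pos_nonneg)

lemma lam_add: "i \<le> j \<Longrightarrow> lam t j = lam t i + real (j - i) * valency t"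
  by (simp add: lam_def of_nat_diff algebra_simps)

lemma mu_diag: "i < n \<Longrightarrow> mu t i i = 1"
  using qh unfolding quasi_homogeneous_def by blast

text \<open>
  The spaces of index \<open>i\<close> satisfy the hypotheses of the section on the monomial basis, and the
  ambient space those of the section on direct sums.
\<close>

lemmas A_lam = lam_pos A[OF lam_pos]

lemmas A_hilbert = rkhs_hilbert[OF A_lam]

lemma ambient_hilbert: "hilbert_space (ambient A n t)"
  using qh unfolding quasi_homogeneous_def cowen_douglas_def by blast

lemmas amb_component_in = component_in[of n "\<lambda>i. A (lam t i)", OF A_hilbert, folded ambient_def]
  and amb_component_ge = component_ge[of n "\<lambda>i. A (lam t i)", OF A_hilbert, folded ambient_def]
  and amb_component_le = hnorm_component_le[of n "\<lambda>i. A (lam t i)", OF A_hilbert, folded ambient_def]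
  and amb_summand_in = summand_in[of n "\<lambda>i. A (lam t i)", OF A_hilbert, folded ambient_def]
  and amb_hnorm_summand = hnorm_summand[of n "\<lambda>i. A (lam t i)", OF A_hilbert, folded ambient_def]
  and amb_bounded_component = bounded_op_component[of n "\<lambda>i. A (lam t i)", OF A_hilbert, folded ambient_def]
  and amb_bounded_summand = bounded_op_summand[of n "\<lambda>i. A (lam t i)", OF A_hilbert, folded ambient_def]

lemma atom_in: "w \<in> disc \<Longrightarrow> atom (lam t i) w \<in> hcar (A (lam t i))"
  using atom_deriv_in[OF A_lam, of w i 0] by (simp add: atom_deriv_0)

lemma frame_in: "w \<in> disc \<Longrightarrow> j < n \<Longrightarrow> frame t j w \<in> hcar (ambient A n t)"
  unfolding frame_def
  by (intro hcar_sum[OF ambient_hilbert] hcar_cscale[OF ambient_hilbert] amb_summand_in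
      atom_deriv_in[OF A_lam]) auto

text \<open>
  The shifts of \<open>bounded_derivation\<close> assemble to a bounded strictly upper triangular operator
  \<open>N\<close>, and \<open>1 + N\<close> sends the atom of index \<open>j\<close> to the frame vector of index \<open>j\<close>, since the diagonal
  constants are \<open>1\<close>.
\<close>

lemma atoms_sum_similar:
  assumes val: "valency t \<ge> 2"
  shows "similar_curves (ambient A n t) (qh_curve n t) (ambient A n t) (atoms_sum_curve n t)"
proof (rule similar_curves_sym)
  let ?H = "ambient A n t"
  have "\<exists>D. bounded_op (A (lam t j)) (A (lam t i)) D \<and>
      (\<forall>w\<in>disc. D (atom (lam t j) w) = atom_deriv (lam t i) (j - i) w)" if "i < j" for i j
  proof -
    have "lam t j \<ge> lam t i + 2 * real (j - i)"
      using lam_add[of i j] that val mult_left_mono[OF val, of "real (j - i)"] by simp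
    then show ?thesis
      using bounded_derivation[OF A_lam A_lam, of "j - i" i j] that by (metis zero_less_diff)
  qed
  then obtain D where D: "\<And>i j. i < j \<Longrightarrow> bounded_op (A (lam t j)) (A (lam t i)) (D i j)"
    "\<And>i j w. i < j \<Longrightarrow> w \<in> disc \<Longrightarrow> D i j (atom (lam t j) w) = atom_deriv (lam t i) (j - i) w"
    by metis
  define N where "N F = (\<Sum>j<n. \<Sum>i<j. cscale (mu t i j) (summand i (D i j (component j F))))" for F
  have N: "bounded_op ?H ?H N"
    unfolding N_def
  proof (intro bounded_op_family_sum[OF ambient_hilbert ambient_hilbert] bounded_op_scale[OF ambient_hilbert])
    fix j i assume ij: "j \<in> {..<n}" "i \<in> {..<j}"
    have "bounded_op ?H (A (lam t i)) (\<lambda>F. D i j (component j F))"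
      by (rule bounded_op_compose[OF A_hilbert amb_bounded_component D(1)]) (use ij in auto)
    then show "bounded_op ?H ?H (\<lambda>F. summand i (D i j (component j F)))"
      by (rule bounded_op_compose[OF A_hilbert _ amb_bounded_summand]) (use ij in auto)
  qed
  have D0: "i < j \<Longrightarrow> D i j 0 = 0" for i j
    by (rule bounded_op_0[OF A_hilbert D(1)])
  \<comment> \<open>Each application of \<open>N\<close> clears one more component, from the last one downwards.\<close>
  have nil: "component i ((N ^^ k) F) = 0" if "F \<in> hcar ?H" "i + k \<ge> n" for F i k
    using that(2)
  proof (induction k arbitrary: i)
    case 0
    then show ?case using amb_component_ge[OF that(1)] by simp
  next
    case (Suc k)
    have "component i (cscale c (summand a (D a b (component b ((N ^^ k) F))))) = 0" if "a < b" for a b c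
    proof (cases "i = a")
      case True
      then have "component b ((N ^^ k) F) = 0"
        using Suc.prems that by (intro Suc.IH) simp
      then have "D a b (component b ((N ^^ k) F)) = 0"
        by (simp only: D0[OF that])
      then show ?thesis
        by (simp only: component_cscale component_summand cfun.scale_zero_right if_cancel)
    next
      case False
      then show ?thesis by (simp add: component_cscale component_summand)
    qed
    then have "component i (N ((N ^^ k) F)) = 0"
      unfolding N_def[of "(N ^^ k) F"] component_sum by (intro sum.neutral ballI) simp
    then show ?case by simp
  qed
  have "(N ^^ n) F = 0" if "F \<in> hcar ?H" for F
    using nil[OF that, of _ n] by (intro component_eqI) (simp add: component_zero del: zero_fun_apply)
  then have inv: "bounded_invertible_op ?H ?H (\<lambda>F. F + N F)"
    by (rule bounded_invertible_op_unipotent[OF ambient_hilbert N])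
  then have bnd: "bounded_op ?H ?H (\<lambda>F. F + N F)"
    by (simp add: bounded_invertible_op_def)
  have fr: "summand j (atom (lam t j) w) + N (summand j (atom (lam t j) w)) = frame t j w"
    if w: "w \<in> disc" and j: "j < n" for j w
  proof -
    have "(\<Sum>i<b. cscale (mu t i b) (summand i (D i b (component b (summand j (atom (lam t j) w)))))) =
        (if b = j then \<Sum>i<j. cscale (mu t i j) (summand i (atom_deriv (lam t i) (j - i) w)) else 0)" for b
      using D(2)[OF _ w] D0 by (auto simp: component_summand summand_zero intro!: sum.cong sum.neutral)
    then have "N (summand j (atom (lam t j) w)) =
        (\<Sum>i<j. cscale (mu t i j) (summand i (atom_deriv (lam t i) (j - i) w)))"
      using j by (simp add: N_def)
    then show ?thesis
      using mu_diag[OF j]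
      by (simp add: frame_def atom_deriv_0 add.commute flip: lessThan_Suc_atMost)
  qed
  have sub: "(\<lambda>i. summand i (atom (lam t i) w)) ` {..<n} \<subseteq> hcar ?H" if "w \<in> disc" for w
    using atom_in[OF that] by (auto intro: amb_summand_in)
  show "atoms_sum_curve n t w \<subseteq> hcar ?H" if "w \<in> disc" for w
    unfolding atoms_sum_curve_def
    by (rule cfun.span_minimal[OF sub[OF that] hcar_subspace[OF ambient_hilbert]])
  have "(\<lambda>F. F + N F) ` atoms_sum_curve n t w = qh_curve n t w" if w: "w \<in> disc" for w
  proof -
    have "(\<lambda>F. F + N F) ` (\<lambda>i. summand i (atom (lam t i) w)) ` {..<n} = (\<lambda>j. frame t j w) ` {..<n}"
      unfolding image_image by (intro image_cong) (use fr[OF w] in auto)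
    then show ?thesis
      unfolding atoms_sum_curve_def qh_curve_def
      by (simp only: bounded_op_image_span[OF ambient_hilbert bnd sub[OF w]])
  qed
  then show "similar_curves ?H (atoms_sum_curve n t) ?H (qh_curve n t)"
    unfolding similar_curves_def using inv by blast
qed

end

section \<open>Growth of the coefficients\<close>

text \<open>
  This is the limit formula of Gauss for the Gamma function.
\<close>

lemma kcoef_asymptotics:
  assumes l: "l > 0"
  shows "(\<lambda>k. kcoef l k * real k powr (1 - l)) \<longlonglongrightarrow> inverse (Gamma l)"
proof -
  have "(\<lambda>k. inverse (Gamma_series l k) * (real k / (l + real k))) \<longlonglongrightarrow> inverse (Gamma l) * 1"
  proof (intro tendsto_mult tendsto_inverse Gamma_series_LIMSEQ)
    show "Gamma l \<noteq> 0" using Gamma_real_pos[OF l] by simp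
    show "(\<lambda>k. real k / (l + real k)) \<longlonglongrightarrow> 1" by real_asymp
  qed
  moreover have "eventually (\<lambda>k. inverse (Gamma_series l k) * (real k / (l + real k)) =
      kcoef l k * real k powr (1 - l)) sequentially"
    using eventually_gt_at_top[of 0]
  proof eventually_elim
    case (elim k)
    have "Gamma_series l k = fact k * exp (l * ln (real k)) / (pochhammer l k * (l + real k))"
      by (simp add: Gamma_series_def pochhammer_Suc)
    then have "inverse (Gamma_series l k) * (real k / (l + real k)) =
        pochhammer l k / fact k * (inverse (exp (l * ln (real k))) * real k)"
      using l by (simp add: divide_inverse)
    also have "inverse (exp (l * ln (real k))) * real k = real k powr (1 - l)"
      using elim by (simp add: powr_def exp_diff left_diff_distrib divide_inverse)
    finally show ?case by (simp add: kcoef_def)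
  qed
  ultimately show ?thesis
    using tendsto_cong by fastforce
qed

text \<open>
  The exponents of growth are \<open>a - 1\<close>, \<open>b - 1\<close> and \<open>c - 1\<close>. A quotient with two factors in the
  denominator covers both decay statements below: the identities \<open>kcoef_shift\<close> and
  \<open>rise_conv_kcoef\<close> express shifted indices through a second \<open>kcoef\<close> at the same index.
\<close>

lemma kcoef_ratio_tendsto_0:
  assumes "a > 0" "b > 0" "c > 0" "a + 1 < b + c"
  shows "(\<lambda>k. kcoef a k / (kcoef b k * kcoef c k)) \<longlonglongrightarrow> 0"
proof -
  let ?u = "\<lambda>l k. kcoef l k * real k powr (1 - l)"
  have "(\<lambda>k. ?u a k / (?u b k * ?u c k) * real k powr (a + 1 - b - c)) \<longlonglongrightarrow>
      inverse (Gamma a) / (inverse (Gamma b) * inverse (Gamma c)) * 0"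
  proof (intro tendsto_mult tendsto_divide kcoef_asymptotics assms)
    show "inverse (Gamma b) * inverse (Gamma c) \<noteq> 0"
      using Gamma_real_pos[OF assms(2)] Gamma_real_pos[OF assms(3)] by simp
    show "(\<lambda>k. real k powr (a + 1 - b - c)) \<longlonglongrightarrow> 0"
      using assms(4) by (intro tendsto_neg_powr filterlim_real_sequentially) simp
  qed
  moreover have "eventually (\<lambda>k. ?u a k / (?u b k * ?u c k) * real k powr (a + 1 - b - c) =
      kcoef a k / (kcoef b k * kcoef c k)) sequentially"
    using eventually_gt_at_top[of 0]
  proof eventually_elim
    case (elim k)
    then have "real k powr (1 - a) * real k powr (a + 1 - b - c) = real k powr (1 - b) * real k powr (1 - c)"
      by (simp flip: powr_add)
    moreover have "real k powr (1 - b) * real k powr (1 - c) \<noteq> 0" using elim by simp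
    ultimately show ?case
      using kcoef_pos[OF assms(2), of k] kcoef_pos[OF assms(3), of k] by (simp add: field_simps)
  qed
  ultimately show ?thesis
    using tendsto_cong by fastforce
qed

lemma kcoef_shift: "kcoef l (q + m) = pochhammer l m * kcoef (l + m) q / (fact m * kcoef (1 + m) q)"
  using rise_kcoef[of q m l] kcoef_pos[of "1 + m" q] unfolding rise_conv_kcoef by (simp add: field_simps)

lemma kcoef_ratio_shift_tendsto_0:
  assumes "0 < a" "a < b"
  shows "(\<lambda>k. sqrt (kcoef a (k + s) / kcoef b k)) \<longlonglongrightarrow> 0"
proof -
  have "(\<lambda>k. pochhammer a s / fact s * (kcoef (a + s) k / (kcoef (1 + s) k * kcoef b k))) \<longlonglongrightarrow> pochhammer a s / fact s * 0"
    using assms by (intro tendsto_mult tendsto_const kcoef_ratio_tendsto_0) auto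
  then have "(\<lambda>k. kcoef a (k + s) / kcoef b k) \<longlonglongrightarrow> 0"
    by (simp add: kcoef_shift mult_ac)
  from tendsto_real_sqrt[OF this] show ?thesis by simp
qed

text \<open>
  With \<open>b = a + m * valency\<close> the hypothesis says that the valency is less than \<open>2\<close>: the shift
  that takes \<open>kcoef b k * z ^ k\<close> to \<open>rise k m * kcoef a (k + m) * z ^ (k + m)\<close> multiplies the norm by
  the inverse of this sequence, and so is unbounded.
\<close>

lemma inverse_rise_kcoef_ratio_tendsto_0:
  assumes "0 < a" "0 < b" "b < a + 2 * real m"
  shows "(\<lambda>k. sqrt (kcoef b k / kcoef a (k + m)) / rise k m) \<longlonglongrightarrow> 0"
proof -
  have "(\<lambda>k. inverse (pochhammer a m * fact m) * (kcoef b k / (kcoef (a + m) k * kcoef (1 + m) k))) \<longlonglongrightarrow>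
      inverse (pochhammer a m * fact m) * 0"
    using assms by (intro tendsto_mult tendsto_const kcoef_ratio_tendsto_0) auto
  moreover have "inverse (pochhammer a m * fact m) * (kcoef b k / (kcoef (a + m) k * kcoef (1 + m) k)) =
      kcoef b k / kcoef a (k + m) / (rise k m)\<^sup>2" for k
  proof -
    have "kcoef a (k + m) * (rise k m)\<^sup>2 = (pochhammer a m * kcoef (a + m) k) * (fact m * kcoef (1 + m) k)"
      unfolding power2_eq_square
      by (simp only: rise_kcoef[symmetric] rise_conv_kcoef[symmetric] mult_ac)
    then show ?thesis by (simp add: field_simps)
  qed
  ultimately have "(\<lambda>k. kcoef b k / kcoef a (k + m) / (rise k m)\<^sup>2) \<longlonglongrightarrow> 0" by simp
  moreover have "sqrt (y / (rise k m)\<^sup>2) = sqrt y / rise k m" for y k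
    using rise_pos[of k m] by (simp add: real_sqrt_divide less_imp_le)
  ultimately show ?thesis
    using tendsto_real_sqrt[of "\<lambda>k. kcoef b k / kcoef a (k + m) / (rise k m)\<^sup>2" 0] by (simp only: real_sqrt_zero)
qed

section \<open>Matrix coefficients of bounded operators\<close>

text \<open>
  A Taylor coefficient of the image is a continuous functional, so it may be applied to the
  expansion of \<open>f\<close> in norm.
\<close>

lemma bounded_op_taylor_sums:
  assumes l: "l > 0" "disc_rkhs l H" and l': "l' > 0" "disc_rkhs l' H'"
    and X: "bounded_op H H' X" and f: "f \<in> hcar H"
  shows "(\<lambda>k. taylor f k * taylor (X (monomial k)) p) sums taylor (X f) p"
proof -
  note HS = rkhs_hilbert[OF l] and HS' = rkhs_hilbert[OF l']
  let ?s = "\<lambda>N. \<Sum>k<N. cscale (taylor f k) (monomial k)"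
  have s: "?s N \<in> hcar H" for N by (rule monomial_sum_in[OF l])
  obtain C where C: "\<And>f. f \<in> hcar H \<Longrightarrow> hnorm H' (X f) \<le> C * hnorm H f"
    using X unfolding bounded_op_def by blast
  have diff: "X (?s N) - X f = X (?s N - f)" for N
  proof -
    have "X (?s N - f + f) = X (?s N - f) + X f"
      by (rule bounded_op_add[OF X hcar_diff[OF HS s f] f])
    then show ?thesis by simp
  qed
  have "(\<lambda>N. hnorm H' (X (?s N) - X f)) \<longlonglongrightarrow> 0"
  proof (rule Lim_null_comparison[OF always_eventually[OF allI]])
    show "(\<lambda>N. C * hnorm H (?s N - f)) \<longlonglongrightarrow> 0"
      using tendsto_mult_left[OF taylor_expansion_limit[OF l f], of C] by simp
    show "norm (hnorm H' (X (?s N) - X f)) \<le> C * hnorm H (?s N - f)" for N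
      using C[OF hcar_diff[OF HS s f]] hnorm_nonneg[OF HS' bounded_op_in[OF X hcar_diff[OF HS s f]]]
      by (simp add: diff)
  qed
  then have "(\<lambda>N. inprod H' (X (?s N)) (monomial p)) \<longlonglongrightarrow> inprod H' (X f) (monomial p)"
    by (intro tendsto_inprod_left[OF HS' bounded_op_in[OF X s] bounded_op_in[OF X f] rkhs_monomial[OF l']])
  then have "(\<lambda>N. of_real (kcoef l' p) * inprod H' (X (?s N)) (monomial p)) \<longlonglongrightarrow>
      of_real (kcoef l' p) * inprod H' (X f) (monomial p)"
    by (intro tendsto_mult tendsto_const)
  then have "(\<lambda>N. taylor (X (?s N)) p) \<longlonglongrightarrow> taylor (X f) p"
    by (simp only: taylor_eq_inprod[OF l' bounded_op_in[OF X s]] taylor_eq_inprod[OF l' bounded_op_in[OF X f]])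
  moreover have "taylor (X (?s N)) p = (\<Sum>k<N. taylor f k * taylor (X (monomial k)) p)" for N
  proof -
    have mono: "monomial k \<in> hcar H" for k by (rule rkhs_monomial[OF l])
    have "X (?s N) = (\<Sum>k<N. cscale (taylor f k) (X (monomial k)))"
      by (simp add: bounded_op_sum[OF HS X hcar_cscale[OF HS mono]] bounded_op_cscale[OF X mono])
    also have "\<dots> = (\<lambda>z. \<Sum>k<N. taylor f k * X (monomial k) z)"
      by (simp add: fun_eq_iff sum_fun_apply cscale_apply)
    finally show ?thesis
      using taylor_finite[of "{..<N}" "\<lambda>k. X (monomial k)" "taylor f" p]
        rkhs_holomorphic[OF l' bounded_op_in[OF X mono]] by simp
  qed
  ultimately show ?thesis by (simp add: sums_def)
qed

lemma span_lessThanE: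
  fixes g :: "nat \<Rightarrow> 'a \<Rightarrow> complex"
  assumes "f \<in> cfun.span (g ` {..<n})"
  obtains c where "f = (\<Sum>l<n. cscale (c l) (g l))"
proof -
  let ?V = "{f. \<exists>c. f = (\<Sum>l<n. cscale (c l) (g l))}"
  have "cfun.subspace ?V"
  proof (rule cfun.subspaceI)
    show "0 \<in> ?V" by (auto intro!: exI[of _ "\<lambda>_. 0"] simp: fun_eq_iff sum_fun_apply cscale_apply)
  next
    fix x y assume "x \<in> ?V" "y \<in> ?V"
    then obtain c d where "x = (\<Sum>l<n. cscale (c l) (g l))" "y = (\<Sum>l<n. cscale (d l) (g l))" by blast
    then have "x + y = (\<Sum>l<n. cscale (c l + d l) (g l))"
      by (simp add: cfun.scale_left_distrib sum.distrib)
    then show "x + y \<in> ?V" unfolding mem_Collect_eq by (rule exI[of _ "\<lambda>l. c l + d l"])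
  next
    fix a x assume "x \<in> ?V"
    then obtain c where "x = (\<Sum>l<n. cscale (c l) (g l))" by blast
    then have "cscale a x = (\<Sum>l<n. cscale (a * c l) (g l))"
      by (simp add: cfun.scale_sum_right)
    then show "cscale a x \<in> ?V" unfolding mem_Collect_eq by (rule exI[of _ "\<lambda>l. a * c l"])
  qed
  moreover have "g ` {..<n} \<subseteq> ?V"
  proof
    fix x assume "x \<in> g ` {..<n}"
    then obtain j where j: "j < n" "x = g j" by blast
    have "x = (\<Sum>l<n. cscale (if l = j then 1 else 0) (g l))"
      using j by (simp add: if_distrib[of "\<lambda>c. cscale c _"] cong: if_cong)
    then show "x \<in> ?V" unfolding mem_Collect_eq by (rule exI[of _ "\<lambda>l. if l = j then 1 else 0"])
  qed
  ultimately have "cfun.span (g ` {..<n}) \<subseteq> ?V" by (intro cfun.span_minimal)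
  with assms that show thesis by blast
qed

section \<open>Rigidity of quasi-homogeneous curves\<close>

text \<open>
  An operator that maps the first curve into the second one. Equality of the parameters is what
  makes the two ambient spaces agree.
\<close>

locale qh_intertwiner = qh_setting A n t + target: qh_setting A n t'
  for A n t t' +
  fixes X :: "(nat \<times> complex \<Rightarrow> complex) \<Rightarrow> nat \<times> complex \<Rightarrow> complex"
  assumes lam_eq: "lam t' = lam t"
    and X: "bounded_op (ambient A n t) (ambient A n t) X"
    and X_frame: "\<And>w j. w \<in> disc \<Longrightarrow> j < n \<Longrightarrow> X (frame t j w) \<in> qh_curve n t' w"
begin

definition block :: "nat \<Rightarrow> nat \<Rightarrow> (complex \<Rightarrow> complex) \<Rightarrow> complex \<Rightarrow> complex"
  where "block i l f = component i (X (summand l f))"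

lemma block_bounded: "i < n \<Longrightarrow> l < n \<Longrightarrow> bounded_op (A (lam t l)) (A (lam t i)) (block i l)"
  unfolding block_def
  by (rule bounded_op_compose[OF ambient_hilbert _ amb_bounded_component],
      rule bounded_op_compose[OF ambient_hilbert amb_bounded_summand X])

text \<open>
  The matrix entry with row \<open>(i, p)\<close> and column \<open>(l, k)\<close>: the coefficient of \<open>z ^ p\<close> in component
  \<open>i\<close> of the image of the vector \<open>kcoef (lam t l) k * z ^ k\<close> in component \<open>l\<close>. With this scaling
  of the columns the atoms are the sums of \<open>w ^ k\<close> times the basis vectors, and all relations
  below have the numbers \<open>rise\<close> as their only weights on the side of the columns.
\<close>

definition entry :: "nat \<Rightarrow> nat \<Rightarrow> nat \<Rightarrow> nat \<Rightarrow> complex"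
  where "entry i p l k = of_real (kcoef (lam t l) k) * taylor (block i l (monomial k)) p"

lemma kcoef_lam_pos: "kcoef (lam t l) k > 0"
  by (rule kcoef_pos[OF lam_pos])

lemma entry_bound:
  obtains C where "\<And>i p l k. i < n \<Longrightarrow> l < n \<Longrightarrow>
    cmod (entry i p l k) \<le> C * sqrt (kcoef (lam t l) k * kcoef (lam t i) p)"
proof -
  obtain C where C: "C \<ge> 0" "\<And>f. f \<in> hcar (ambient A n t) \<Longrightarrow>
      hnorm (ambient A n t) (X f) \<le> C * hnorm (ambient A n t) f"
    using bounded_op_bound[OF ambient_hilbert X] by blast
  show thesis
  proof (rule that)
    fix i p l k assume i: "i < n" and l: "l < n"
    let ?a = "kcoef (lam t l) k" and ?b = "kcoef (lam t i) p"
    have mono: "monomial k \<in> hcar (A (lam t l))" by (rule rkhs_monomial[OF A_lam])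
    have "cmod (taylor (block i l (monomial k)) p) \<le> sqrt ?b * hnorm (A (lam t i)) (block i l (monomial k))"
      by (rule taylor_bound[OF A_lam bounded_op_in[OF block_bounded[OF i l] mono]])
    also have "hnorm (A (lam t i)) (block i l (monomial k)) \<le> C * hnorm (A (lam t l)) (monomial k)"
      unfolding block_def amb_hnorm_summand[OF mono l, symmetric]
      using amb_component_le[OF bounded_op_in[OF X amb_summand_in[OF mono l]] i]
        C(2)[OF amb_summand_in[OF mono l]] by linarith
    also have "hnorm (A (lam t l)) (monomial k) = 1 / sqrt ?a"
    proof -
      have "sqrt ((hnorm (A (lam t l)) (monomial k))\<^sup>2) = sqrt (1 / ?a)"
        by (simp only: hnorm_monomial[OF A_lam])
      then show ?thesis
        using hnorm_nonneg[OF A_hilbert mono] by (simp add: real_sqrt_divide)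
    qed
    finally have "cmod (taylor (block i l (monomial k)) p) \<le> sqrt ?b * (C * (1 / sqrt ?a))"
      using kcoef_lam_pos[of i p] by (simp add: mult_left_mono)
    then have "?a * cmod (taylor (block i l (monomial k)) p) \<le> ?a * (sqrt ?b * (C * (1 / sqrt ?a)))"
      using kcoef_lam_pos[of l k] by (intro mult_left_mono) auto
    then have "cmod (entry i p l k) \<le> ?a * (sqrt ?b * (C * (1 / sqrt ?a)))"
      using kcoef_lam_pos[of l k] by (simp only: entry_def norm_mult norm_of_real abs_of_pos)
    also have "\<dots> = C * sqrt (?a * ?b)"
      using kcoef_lam_pos[of l k] real_sqrt_mult_self[of ?a]
      by (simp add: real_sqrt_mult field_simps)
    finally show "cmod (entry i p l k) \<le> C * sqrt (?a * ?b)" .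
  qed
qed

text \<open>
  The coefficient of \<open>w ^ q * z ^ p\<close> in component \<open>i\<close> of the image of the frame vector of index
  \<open>j\<close> at \<open>w\<close>; see \<open>frame_entry_sums\<close>.
\<close>

definition frame_entry :: "nat \<Rightarrow> nat \<Rightarrow> nat \<Rightarrow> nat \<Rightarrow> complex"
  where "frame_entry j i p q =
    (\<Sum>l\<le>j. mu t l j * (of_real (rise q (j - l)) * entry i p l (q + (j - l))))"

lemma frame_entry_sums:
  assumes w: "w \<in> disc" and i: "i < n" and j: "j < n"
  shows "(\<lambda>q. frame_entry j i p q * w ^ q) sums taylor (component i (X (frame t j w))) p"
proof -
  let ?f = "\<lambda>l. atom_deriv (lam t l) (j - l) w"
  have f: "?f l \<in> hcar (A (lam t l))" for l by (rule atom_deriv_in[OF A_lam w])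
  have S: "(\<lambda>q. of_real (rise q m) * entry i p l (q + m) * w ^ q) sums
      taylor (block i l (atom_deriv (lam t l) m w)) p" if l: "l < n" for l m
  proof -
    have "(\<lambda>k. taylor (atom_deriv (lam t l) m w) k * taylor (block i l (monomial k)) p) sums
        taylor (block i l (atom_deriv (lam t l) m w)) p"
      by (rule bounded_op_taylor_sums[OF A_lam A_lam block_bounded[OF i l] atom_deriv_in[OF A_lam w]])
    then have "(\<lambda>q. taylor (atom_deriv (lam t l) m w) (q + m) * taylor (block i l (monomial (q + m))) p) sums
        taylor (block i l (atom_deriv (lam t l) m w)) p"
      by (subst sums_iff_shift) (simp add: taylor_atom_deriv[OF w])
    then show ?thesis
      by (simp add: taylor_atom_deriv[OF w] entry_def mult_ac)
  qed
  have blk: "block i l (?f l) \<in> hcar (A (lam t i))" if "l < n" for l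
    by (rule bounded_op_in[OF block_bounded[OF i that] f])
  have sm: "summand l (?f l) \<in> hcar (ambient A n t)" if "l < n" for l
    by (rule amb_summand_in[OF f that])
  have "X (frame t j w) = (\<Sum>l\<le>j. cscale (mu t l j) (X (summand l (?f l))))"
  proof -
    have "X (frame t j w) = (\<Sum>l\<le>j. X (cscale (mu t l j) (summand l (?f l))))"
      unfolding frame_def
      using j by (intro bounded_op_sum[OF ambient_hilbert X] hcar_cscale[OF ambient_hilbert] sm) simp
    also have "\<dots> = (\<Sum>l\<le>j. cscale (mu t l j) (X (summand l (?f l))))"
      using j by (intro sum.cong bounded_op_cscale[OF X] sm) simp_all
    finally show ?thesis .
  qed
  then have "component i (X (frame t j w)) = (\<Sum>l\<le>j. cscale (mu t l j) (block i l (?f l)))"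
    by (simp only: component_sum component_cscale block_def)
  also have "\<dots> = (\<lambda>z. \<Sum>l\<le>j. mu t l j * block i l (?f l) z)"
    by (simp add: fun_eq_iff sum_fun_apply cscale_apply)
  finally have "component i (X (frame t j w)) = (\<lambda>z. \<Sum>l\<le>j. mu t l j * block i l (?f l) z)" .
  moreover have "taylor (\<lambda>z. \<Sum>l\<le>j. mu t l j * block i l (?f l) z) p =
      (\<Sum>l\<le>j. mu t l j * taylor (block i l (?f l)) p)"
    using j by (intro taylor_finite rkhs_holomorphic[OF A_lam blk]) simp_all
  moreover have "(\<lambda>q. \<Sum>l\<le>j. mu t l j * (of_real (rise q (j - l)) * entry i p l (q + (j - l)) * w ^ q)) sums
      (\<Sum>l\<le>j. mu t l j * taylor (block i l (?f l)) p)"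
    using j by (intro sums_sum sums_mult S) simp
  ultimately show ?thesis
    by (simp add: frame_entry_def sum_distrib_right mult.assoc)
qed

text \<open>
  At \<open>z = 0\<close> component \<open>l\<close> of a frame vector vanishes unless the vector has index \<open>l\<close>, because a
  derivative of an atom vanishes there. So the coordinates of the image with respect to the
  second frame are the values at \<open>0\<close> of its components.
\<close>

definition multiplier :: "nat \<Rightarrow> complex \<Rightarrow> nat \<Rightarrow> complex"
  where "multiplier j w l = taylor (component l (X (frame t j w))) 0"

lemma taylor_component_sum_frame:
  assumes w: "w \<in> disc" and i: "i < n"
  shows "taylor (component i (\<Sum>l<n. cscale (c l) (frame t' l w))) p =
    (\<Sum>l<n. if i \<le> l \<and> l \<le> p + i then
      mu t' i l * of_real (rise (p + i - l) (l - i) * kcoef (lam t i) p) * (w ^ (p + i - l) * c l) else 0)"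
proof -
  have comp: "component i (frame t' l w) = (if i \<le> l then cscale (mu t' i l) (atom_deriv (lam t i) (l - i) w) else 0)" for l
  proof -
    have "component i (frame t' l w) =
        (\<Sum>k\<le>l. if k = i then cscale (mu t' i l) (atom_deriv (lam t i) (l - i) w) else 0)"
      unfolding frame_def component_sum component_cscale component_summand lam_eq
      by (intro sum.cong) auto
    then show ?thesis by simp
  qed
  have hol: "component i (frame t' l w) holomorphic_on disc" if "l < n" for l
    by (rule rkhs_holomorphic[OF target.A_lam target.amb_component_in[OF target.frame_in[OF w that] i]])
  have "component i (\<Sum>l<n. cscale (c l) (frame t' l w)) = (\<lambda>z. \<Sum>l<n. c l * component i (frame t' l w) z)"
    unfolding component_sum component_cscale by (simp add: fun_eq_iff sum_fun_apply cscale_apply)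
  then have "taylor (component i (\<Sum>l<n. cscale (c l) (frame t' l w))) p =
      taylor (\<lambda>z. \<Sum>l<n. c l * component i (frame t' l w) z) p"
    by (simp only:)
  also have "\<dots> = (\<Sum>l<n. c l * taylor (component i (frame t' l w)) p)"
    by (intro taylor_finite hol) simp_all
  also have "\<dots> = (\<Sum>l<n. if i \<le> l \<and> l \<le> p + i then
      mu t' i l * of_real (rise (p + i - l) (l - i) * kcoef (lam t i) p) * (w ^ (p + i - l) * c l) else 0)"
  proof (intro sum.cong refl)
    fix l assume "l \<in> {..<n}"
    show "c l * taylor (component i (frame t' l w)) p = (if i \<le> l \<and> l \<le> p + i then
      mu t' i l * of_real (rise (p + i - l) (l - i) * kcoef (lam t i) p) * (w ^ (p + i - l) * c l) else 0)"
    proof (cases "i \<le> l")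
      case True
      have "p - (l - i) = p + i - l" "l - i \<le> p \<longleftrightarrow> l \<le> p + i" using True by auto
      then show ?thesis
        using True unfolding comp
        by (simp add: taylor_cscale[OF rkhs_holomorphic[OF A_lam atom_deriv_in[OF A_lam w]]]
            taylor_atom_deriv[OF w])
    next
      case False
      have "taylor (0 :: complex \<Rightarrow> complex) p = 0"
        using taylor_finite[of "{}" "\<lambda>_ :: nat. 0" "\<lambda>_. 0" p] by (simp add: zero_fun_def)
      then show ?thesis using False unfolding comp by simp
    qed
  qed
  finally show ?thesis .
qed

lemma X_frame_expansion:
  assumes w: "w \<in> disc" and j: "j < n"
  shows "X (frame t j w) = (\<Sum>l<n. cscale (multiplier j w l) (frame t' l w))"
proof -
  obtain c where c: "X (frame t j w) = (\<Sum>l<n. cscale (c l) (frame t' l w))"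
    using X_frame[OF w j] unfolding qh_curve_def by (rule span_lessThanE)
  have "multiplier j w l = c l" if l: "l < n" for l
  proof -
    have "multiplier j w l = (\<Sum>k<n. if k = l then c l else 0)"
      unfolding multiplier_def c taylor_component_sum_frame[OF w l]
      by (intro sum.cong) (auto simp: rise_0 kcoef_0 target.mu_diag l)
    then show ?thesis using l by simp
  qed
  then show ?thesis using c by simp
qed

text \<open>
  Both sides are the coefficients of \<open>w ^ q\<close> in one power series. The left one expands the image
  of the frame vector directly; the right one expands it in the second frame, whose coordinates
  are the power series with coefficients \<open>frame_entry j l 0\<close> by \<open>frame_entry_sums\<close>.
\<close>

lemma frame_entry_recurrence:
  assumes i: "i < n" and j: "j < n"
  shows "frame_entry j i p q = (\<Sum>l<n. if i \<le> l \<and> l \<le> p + i \<and> p + i - l \<le> q then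
    mu t' i l * of_real (rise (p + i - l) (l - i) * kcoef (lam t i) p) * frame_entry j l 0 (q - (p + i - l)) else 0)"
    (is "_ = ?rhs q")
proof (rule powser_disc_eq[where a = "frame_entry j i p" and b = ?rhs
      and f = "\<lambda>w. taylor (component i (X (frame t j w))) p" and k = q])
  show "(\<lambda>q. frame_entry j i p q * w ^ q) sums taylor (component i (X (frame t j w))) p" if "w \<in> disc" for w
    by (rule frame_entry_sums[OF that i j])
  fix w assume w: "w \<in> disc"
  have tay: "taylor (component i (X (frame t j w))) p =
      (\<Sum>l<n. if i \<le> l \<and> l \<le> p + i then
        mu t' i l * of_real (rise (p + i - l) (l - i) * kcoef (lam t i) p) * (w ^ (p + i - l) * multiplier j w l) else 0)"
    using X_frame_expansion[OF w j] taylor_component_sum_frame[OF w i, of "multiplier j w"] by simp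
  have "(\<lambda>q. \<Sum>l<n. if i \<le> l \<and> l \<le> p + i then
      mu t' i l * of_real (rise (p + i - l) (l - i) * kcoef (lam t i) p) *
        ((if p + i - l \<le> q then frame_entry j l 0 (q - (p + i - l)) else 0) * w ^ q) else 0) sums
      taylor (component i (X (frame t j w))) p"
    unfolding tay
  proof (rule sums_sum)
    fix l assume "l \<in> {..<n}"
    then have "(\<lambda>q. frame_entry j l 0 q * w ^ q) sums multiplier j w l"
      unfolding multiplier_def using frame_entry_sums[OF w _ j] by simp
    from sums_mult[OF powser_shift_sums[OF this, of "p + i - l"],
        of "mu t' i l * of_real (rise (p + i - l) (l - i) * kcoef (lam t i) p)"]
    show "(\<lambda>q. if i \<le> l \<and> l \<le> p + i then
      mu t' i l * of_real (rise (p + i - l) (l - i) * kcoef (lam t i) p) *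
        ((if p + i - l \<le> q then frame_entry j l 0 (q - (p + i - l)) else 0) * w ^ q) else 0) sums
      (if i \<le> l \<and> l \<le> p + i then
        mu t' i l * of_real (rise (p + i - l) (l - i) * kcoef (lam t i) p) * (w ^ (p + i - l) * multiplier j w l) else 0)"
      by (cases "i \<le> l \<and> l \<le> p + i") (simp_all only: if_True if_False sums_zero simp_thms)
  qed
  moreover have "(\<Sum>l<n. if i \<le> l \<and> l \<le> p + i then
      mu t' i l * of_real (rise (p + i - l) (l - i) * kcoef (lam t i) p) *
        ((if p + i - l \<le> q then frame_entry j l 0 (q - (p + i - l)) else 0) * w ^ q) else 0) = ?rhs q * w ^ q" for q
    unfolding sum_distrib_right by (intro sum.cong) auto
  ultimately show "(\<lambda>q. ?rhs q * w ^ q) sums taylor (component i (X (frame t j w))) p"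
    by simp
qed

text \<open>
  Below the diagonal the recurrence says that block \<open>(i, l)\<close> is a Toeplitz matrix, up to the
  scaling by \<open>kcoef\<close>: once the subdiagonal blocks in the rows further down, and those further left
  in the same row, are known to vanish, the entry at \<open>(p, q)\<close> is \<open>kcoef (lam t i) p\<close> times a number that depends on \<open>q - p\<close> only. Going down a
  diagonal of the block, \<open>entry_bound\<close> and \<open>lam t l < lam t i\<close> force this number to be \<open>0\<close>.
\<close>

lemma entry_lower_zero:
  assumes val: "valency t > 0" and "i < n" "l < i"
  shows "entry i p l k = 0"
proof -
  obtain C where C: "\<And>i p l k. i < n \<Longrightarrow> l < n \<Longrightarrow>
      cmod (entry i p l k) \<le> C * sqrt (kcoef (lam t l) k * kcoef (lam t i) p)"
    using entry_bound by blast
  have "\<forall>l p k. l < i \<longrightarrow> entry i p l k = 0" if "i < n" for i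
    using that
  proof (induction "n - i" arbitrary: i rule: less_induct)
    case less
    have outer: "entry i' p l k = 0" if "i < i'" "i' < n" "l < i'" for i' p l k
      using less.hyps[of i'] that less.prems by (metis diff_less_mono2)
    have "\<forall>p k. l < i \<longrightarrow> entry i p l k = 0" for l
    proof (induction l rule: less_induct)
      case (less j)
      show ?case
      proof (intro allI impI)
        fix p k assume j: "j < i"
        have inner: "entry i p l k = 0" if "l < j" for l p k
          using less.IH that j by simp
        have above: "frame_entry j l 0 q = 0" if "i < l" "l < n" for l q
          unfolding frame_entry_def using that j by (intro sum.neutral) (simp add: outer)
        have fe: "frame_entry j i p q = entry i p j q" for p q
        proof -
          have "frame_entry j i p q = (\<Sum>l\<le>j. if l = j then entry i p j q else 0)"
            unfolding frame_entry_def
            using j \<open>i < n\<close> by (intro sum.cong) (auto simp: inner mu_diag rise_0)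
          then show ?thesis by simp
        qed
        have rec: "entry i p j q = (if p \<le> q then of_real (kcoef (lam t i) p) * entry i 0 j (q - p) else 0)" for p q
        proof -
          have "entry i p j q = (\<Sum>l<n. if l = i then
              (if p \<le> q then of_real (kcoef (lam t i) p) * frame_entry j i 0 (q - p) else 0) else 0)"
            unfolding fe[symmetric] frame_entry_recurrence[OF \<open>i < n\<close> less_trans[OF j \<open>i < n\<close>], of p q]
            using \<open>i < n\<close> by (intro sum.cong refl) (auto simp: above target.mu_diag rise_0)
          then show ?thesis using \<open>i < n\<close> by (simp add: fe)
        qed
        have zero: "entry i 0 j s = 0" for s
        proof -
          have "cmod (entry i 0 j s) \<le> C * sqrt (kcoef (lam t j) (p + s) / kcoef (lam t i) p)" for p
          proof -
            let ?b = "kcoef (lam t i) p"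
            have b: "?b > 0" by (rule kcoef_lam_pos)
            have "?b * cmod (entry i 0 j s) = cmod (entry i p j (p + s))"
              using b by (simp add: rec[of p "p + s"] norm_mult)
            also have "\<dots> \<le> C * sqrt (kcoef (lam t j) (p + s) * ?b)"
              using j \<open>i < n\<close> by (intro C) auto
            also have "\<dots> = ?b * (C * sqrt (kcoef (lam t j) (p + s) / ?b))"
              using b real_sqrt_mult_self[of ?b] by (simp add: real_sqrt_mult real_sqrt_divide field_simps)
            finally show ?thesis using b by simp
          qed
          moreover have "(\<lambda>p. C * sqrt (kcoef (lam t j) (p + s) / kcoef (lam t i) p)) \<longlonglongrightarrow> C * 0"
            using lam_add[of j i] j val lam_pos[of j]
            by (intro tendsto_mult tendsto_const kcoef_ratio_shift_tendsto_0) auto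
          ultimately have "cmod (entry i 0 j s) \<le> C * 0"
            by (intro LIMSEQ_le_const) auto
          then show ?thesis by simp
        qed
        show "entry i p j k = 0"
          by (simp add: rec[of p k] zero)
      qed
    qed
    then show ?case by blast
  qed
  with assms show ?thesis by blast
qed

text \<open>
  The recurrence for \<open>p = q + (j - i)\<close>. On its right-hand side the condition
  \<open>p + i - l \<le> q\<close> excludes \<open>l < j\<close>, and block triangularity excludes \<open>l > j\<close>; so only the second
  constant \<open>mu t' i j\<close> and the leading entry of the diagonal block \<open>j\<close> remain.
\<close>

lemma entry_intertwining:
  assumes val: "valency t > 0" and ij: "i \<le> j" "j < n"
  shows "(\<Sum>l\<in>{i..j}. mu t l j * (of_real (rise q (j - l)) * entry i (q + (j - i)) l (q + (j - l)))) =
    mu t' i j * of_real (rise q (j - i) * kcoef (lam t i) (q + (j - i))) * entry j 0 j 0"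
proof -
  note lower = entry_lower_zero[OF val]
  have above: "frame_entry j l 0 r = 0" if "j < l" "l < n" for l r
    unfolding frame_entry_def using that by (intro sum.neutral) (simp add: lower)
  have top: "frame_entry j j 0 0 = entry j 0 j 0"
  proof -
    have "frame_entry j j 0 0 = (\<Sum>l\<le>j. if l = j then entry j 0 j 0 else 0)"
      unfolding frame_entry_def using ij by (intro sum.cong) (auto simp: lower mu_diag rise_0)
    then show ?thesis by simp
  qed
  have "(\<Sum>l\<in>{i..j}. mu t l j * (of_real (rise q (j - l)) * entry i (q + (j - i)) l (q + (j - l)))) =
      frame_entry j i (q + (j - i)) q"
    unfolding frame_entry_def using ij by (intro sum.mono_neutral_left) (auto simp: lower)
  also have "\<dots> = (\<Sum>l<n. if l = j then
      mu t' i j * of_real (rise q (j - i) * kcoef (lam t i) (q + (j - i))) * frame_entry j j 0 0 else 0)"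
  proof (subst frame_entry_recurrence)
    show "i < n" "j < n" using ij by auto
    show "(\<Sum>l<n. if i \<le> l \<and> l \<le> q + (j - i) + i \<and> q + (j - i) + i - l \<le> q then
        mu t' i l * of_real (rise (q + (j - i) + i - l) (l - i) * kcoef (lam t i) (q + (j - i))) *
          frame_entry j l 0 (q - (q + (j - i) + i - l)) else 0) =
      (\<Sum>l<n. if l = j then
        mu t' i j * of_real (rise q (j - i) * kcoef (lam t i) (q + (j - i))) * frame_entry j j 0 0 else 0)"
    proof (intro sum.cong refl)
      fix l assume l: "l \<in> {..<n}"
      have e: "q + (j - i) + i = q + j" using ij by simp
      consider "l < j" | "l = j" | "l > j" by linarith
      then show "(if i \<le> l \<and> l \<le> q + (j - i) + i \<and> q + (j - i) + i - l \<le> q then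
        mu t' i l * of_real (rise (q + (j - i) + i - l) (l - i) * kcoef (lam t i) (q + (j - i))) *
          frame_entry j l 0 (q - (q + (j - i) + i - l)) else 0) =
        (if l = j then
          mu t' i j * of_real (rise q (j - i) * kcoef (lam t i) (q + (j - i))) * frame_entry j j 0 0 else 0)"
        unfolding e using l ij by cases (auto simp: above)
    qed
  qed
  finally show ?thesis using ij by (simp add: top)
qed

text \<open>
  In \<open>entry_intertwining\<close> divided by the weight \<open>R q\<close> of its right-hand side, the term \<open>l = i\<close> is
  constant, since the diagonal blocks are Toeplitz matrices. The term of index \<open>l > i\<close> is bounded
  by a multiple of the sequence in \<open>inverse_rise_kcoef_ratio_tendsto_0\<close> with \<open>m = l - i\<close>, and so
  vanishes in the limit.
\<close>

lemma mu_intertwining: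
  assumes val: "0 < valency t" "valency t < 2" and ij: "i < j" "j < n"
  shows "mu t i j * entry i 0 i 0 = mu t' i j * entry j 0 j 0"
proof -
  obtain C where C: "\<And>i p l k. i < n \<Longrightarrow> l < n \<Longrightarrow>
      cmod (entry i p l k) \<le> C * sqrt (kcoef (lam t l) k * kcoef (lam t i) p)"
    using entry_bound by blast
  define p where "p q = q + (j - i)" for q
  define R where "R q = rise q (j - i) * kcoef (lam t i) (p q)" for q
  define T where "T l q = mu t l j * (of_real (rise q (j - l)) * entry i (p q) l (q + (j - l)))" for l q
  have R: "R q > 0" for q
    using rise_pos kcoef_lam_pos by (simp add: R_def)
  have diag: "T i q = of_real (R q) * (mu t i j * entry i 0 i 0)" for q
  proof -
    have "entry i (p q) i (p q) = of_real (kcoef (lam t i) (p q)) * entry i 0 i 0"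
      using entry_intertwining[OF val(1), of i i "p q"] ij
      by (simp add: mu_diag target.mu_diag rise_0)
    then show ?thesis by (simp add: T_def R_def p_def[symmetric] mult_ac)
  qed
  have off: "(\<lambda>q. T l q / of_real (R q)) \<longlonglongrightarrow> 0" if l: "l \<in> {i<..j}" for l
  proof (rule Lim_null_comparison[OF always_eventually[OF allI]])
    define m where "m = l - i"
    let ?u = "\<lambda>k. sqrt (kcoef (lam t l) k / kcoef (lam t i) (k + m)) / rise k m"
    show "norm (T l q / of_real (R q)) \<le> cmod (mu t l j) * C * ?u (q + (j - l))" for q
    proof -
      define k where "k = q + (j - l)"
      have pk: "p q = k + m" using l by (auto simp: p_def k_def m_def)
      let ?a = "kcoef (lam t l) k" and ?b = "kcoef (lam t i) (k + m)"
      have b: "?b > 0" by (rule kcoef_lam_pos)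
      have rr: "rise q (j - i) = rise q (j - l) * rise k m"
      proof -
        have "q + (j - i) = k + m" using pk by (simp add: p_def)
        then show ?thesis by (simp add: rise_def k_def add.assoc)
      qed
      have "cmod (entry i (p q) l k) \<le> C * sqrt (?a * ?b)"
        unfolding pk using l ij by (intro C) auto
      also have "\<dots> = ?b * (C * sqrt (?a / ?b))"
        using b real_sqrt_mult_self[of ?b] by (simp add: real_sqrt_mult real_sqrt_divide field_simps)
      finally have e: "cmod (entry i (p q) l k) / ?b \<le> C * sqrt (?a / ?b)"
        using b by (simp add: field_simps)
      have "norm (T l q / of_real (R q)) = cmod (mu t l j) / rise k m * (cmod (entry i (p q) l k) / ?b)"
        using rise_pos[of q "j - l"] rise_pos[of k m] b
        by (simp add: T_def R_def pk rr norm_mult norm_divide k_def[symmetric])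
      also have "\<dots> \<le> cmod (mu t l j) / rise k m * (C * sqrt (?a / ?b))"
        using rise_pos[of k m] by (intro mult_left_mono e) simp
      finally show ?thesis by (simp add: k_def)
    qed
    have "real m > 0" using l by (simp add: m_def)
    from mult_strict_left_mono[OF val(2) this] have "real m * valency t < 2 * real m"
      by linarith
    then have "?u \<longlonglongrightarrow> 0"
      using lam_add[of i l] l lam_pos[of i] lam_pos[of l]
      by (intro inverse_rise_kcoef_ratio_tendsto_0) (auto simp: m_def)
    then have "(\<lambda>q. ?u (q + (j - l))) \<longlonglongrightarrow> 0"
      by (rule LIMSEQ_ignore_initial_segment)
    from tendsto_mult_left[OF this, of "cmod (mu t l j) * C"]
    show "(\<lambda>q. cmod (mu t l j) * C * ?u (q + (j - l))) \<longlonglongrightarrow> 0" by simp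
  qed
  have "mu t i j * entry i 0 i 0 + (\<Sum>l\<in>{i<..j}. T l q / of_real (R q)) = mu t' i j * entry j 0 j 0" for q
  proof -
    have "{i..j} = insert i {i<..j}" using ij by auto
    then have "T i q + (\<Sum>l\<in>{i<..j}. T l q) = mu t' i j * of_real (R q) * entry j 0 j 0"
      using entry_intertwining[OF val(1), of i j q] ij by (simp add: T_def R_def p_def)
    then have "(T i q + (\<Sum>l\<in>{i<..j}. T l q)) / of_real (R q) = mu t' i j * entry j 0 j 0"
      using R[of q] by simp
    then show ?thesis
      using R[of q] by (simp add: diag add_divide_distrib sum_divide_distrib)
  qed
  moreover have "(\<lambda>q. mu t i j * entry i 0 i 0 + (\<Sum>l\<in>{i<..j}. T l q / of_real (R q))) \<longlonglongrightarrow>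
      mu t i j * entry i 0 i 0 + (\<Sum>l\<in>{i<..j}. 0)"
    by (intro tendsto_add tendsto_const tendsto_sum off)
  ultimately show ?thesis
    by (simp add: LIMSEQ_const_iff)
qed

text \<open>
  By triangularity the first frame vector at \<open>0\<close> is mapped to this entry times the first vector of
  the second frame at \<open>0\<close>.
\<close>

lemma corner_entry_nonzero:
  assumes val: "valency t > 0" and n: "n > 0"
    and inj: "\<And>f. f \<in> hcar (ambient A n t) \<Longrightarrow> X f = 0 \<Longrightarrow> f = 0"
  shows "entry 0 0 0 0 \<noteq> 0"
proof
  assume c: "entry 0 0 0 0 = 0"
  have "multiplier 0 0 l = 0" if l: "l < n" for l
  proof -
    have "multiplier 0 0 l = frame_entry 0 l 0 0"
      using frame_entry_sums[of 0 l 0 0] l n unfolding multiplier_def by simp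
    also have "\<dots> = 0"
      using entry_lower_zero[OF val l, of 0 0 0] c by (cases "l = 0") (auto simp: frame_entry_def)
    finally show ?thesis .
  qed
  then have "X (frame t 0 0) = 0"
    using X_frame_expansion[of 0 0] n by simp
  then have "frame t 0 0 = 0"
    by (rule inj[rotated]) (use frame_in[of 0 0] n in simp)
  then have "frame t 0 0 (0, 0) = 0" by simp
  then show False
    using n by (simp add: frame_def mu_diag cscale_apply summand_def atom_deriv_0 atom_def)
qed

text \<open>
  The superdiagonal constants agree and are nonzero, so \<open>mu_intertwining\<close> for \<open>j = i + 1\<close> makes the
  leading entries of all diagonal blocks equal. Then they cancel for every \<open>j\<close>.
\<close>

lemma mu_eq:
  assumes val: "0 < valency t" "valency t < 2" and ij: "i \<le> j" "j < n"
    and super: "\<And>i. i + 1 < n \<Longrightarrow> mu t i (i + 1) = mu t' i (i + 1)"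
    and inj: "\<And>f. f \<in> hcar (ambient A n t) \<Longrightarrow> X f = 0 \<Longrightarrow> f = 0"
  shows "mu t i j = mu t' i j"
proof -
  have const: "entry k 0 k 0 = entry 0 0 0 0" if "k < n" for k
    using that
  proof (induction k)
    case (Suc k)
    have "mu t k (k + 1) \<noteq> 0"
      using qh Suc.prems unfolding quasi_homogeneous_def by simp
    then show ?case
      using Suc mu_intertwining[OF val, of k "k + 1"] super[of k] by simp
  qed simp
  have "entry 0 0 0 0 \<noteq> 0"
    by (rule corner_entry_nonzero[OF val(1) _ inj]) (use ij in simp)
  then show ?thesis
    using mu_intertwining[OF val, of i j] ij const[of i] const[of j] mu_diag target.mu_diag
    by (cases "i = j") auto
qed

end

section \<open>The second fundamental forms determine the first superdiagonal\<close>

lemma disc_square: "w \<in> disc \<Longrightarrow> (cmod w)\<^sup>2 < 1"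
  by (simp add: abs_square_less_1)

text \<open>
  The Wirtinger derivatives at a point of the disc depend only on the values on the disc.
\<close>

lemma wirtinger_eqI:
  assumes "w \<in> disc" "\<And>v. v \<in> disc \<Longrightarrow> f v = g v" "(g has_derivative D) (at w)"
  shows "wirtinger f w = (D 1 - \<i> * D \<i>) / 2" "wirtinger_bar f w = (D 1 + \<i> * D \<i>) / 2"
proof -
  have "(f has_derivative D) (at w)"
    using assms(2) by (intro has_derivative_transform_within_open[OF assms(3) open_ball assms(1)]) simp
  then have "frechet_derivative f (at w) = D"
    by (rule frechet_derivative_at[symmetric])
  then show "wirtinger f w = (D 1 - \<i> * D \<i>) / 2" "wirtinger_bar f w = (D 1 + \<i> * D \<i>) / 2"
    by (simp_all add: wirtinger_def wirtinger_bar_def)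
qed

lemma has_derivative_cmod_square:
  "((\<lambda>v. (cmod v)\<^sup>2) has_derivative (\<lambda>h. 2 * (Re v * Re h + Im v * Im h))) (at v)"
  unfolding cmod_power2 by (auto intro!: derivative_eq_intros simp: algebra_simps)

text \<open>
  The inner derivative is \<open>L * v / (1 - (cmod v)^2)\<close>.
\<close>

lemma wirtinger_log_kernel:
  assumes f: "\<And>v. v \<in> disc \<Longrightarrow> f v = - L * ln (1 - (cmod v)\<^sup>2)" and w: "w \<in> disc"
  shows "wirtinger (wirtinger_bar (\<lambda>v. complex_of_real (f v))) w = of_real (L / (1 - (cmod w)\<^sup>2)\<^sup>2)"
proof -
  have bar: "wirtinger_bar (\<lambda>v. complex_of_real (f v)) v = of_real L * v / of_real (1 - (cmod v)\<^sup>2)"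
    if v: "v \<in> disc" for v
  proof -
    have x: "1 - (cmod v)\<^sup>2 > 0" using disc_square[OF v] by simp
    have "((\<lambda>v. complex_of_real (- L * ln (1 - (cmod v)\<^sup>2))) has_derivative
        (\<lambda>h. of_real (- L * ((0 - 2 * (Re v * Re h + Im v * Im h)) * inverse (1 - (cmod v)\<^sup>2))))) (at v)"
      using x by (intro has_derivative_of_real has_derivative_mult_right has_derivative_ln
          has_derivative_diff has_derivative_const has_derivative_cmod_square)
    moreover have "- L * ((0 - a) * inverse y) = L * a / y" for a y
      by (simp add: divide_inverse)
    ultimately have "((\<lambda>v. complex_of_real (- L * ln (1 - (cmod v)\<^sup>2))) has_derivative
        (\<lambda>h. of_real (L * (2 * (Re v * Re h + Im v * Im h)) / (1 - (cmod v)\<^sup>2)))) (at v)"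
      by (simp only:)
    from wirtinger_eqI(2)[OF v _ this, of "\<lambda>v. complex_of_real (f v)"]
    have "wirtinger_bar (\<lambda>v. complex_of_real (f v)) v =
        (of_real (L * (2 * Re v) / (1 - (cmod v)\<^sup>2)) + \<i> * of_real (L * (2 * Im v) / (1 - (cmod v)\<^sup>2))) / 2"
      using f by simp
    also have "\<dots> = of_real L * (of_real (Re v) + \<i> * of_real (Im v)) / of_real (1 - (cmod v)\<^sup>2)"
    proof -
      have "(complex_of_real (L * (2 * a) / y) + \<i> * of_real (L * (2 * b) / y)) / 2 =
          of_real L * (of_real a + \<i> * of_real b) / of_real y" for a b y
        by (simp add: add_divide_distrib distrib_left)
      then show ?thesis by (simp only:)
    qed
    finally show ?thesis by (simp only: complex_eq[symmetric])
  qed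
  let ?x = "1 - (cmod w)\<^sup>2"
  have x: "?x > 0" using disc_square[OF w] by simp
  define U where "U = complex_of_real ?x"
  have U: "U \<noteq> 0" using x by (simp add: U_def del: of_real_diff)
  have "((\<lambda>v. complex_of_real (1 - (cmod v)\<^sup>2)) has_derivative
      (\<lambda>h. complex_of_real (0 - 2 * (Re w * Re h + Im w * Im h)))) (at w)"
    by (intro has_derivative_of_real has_derivative_diff has_derivative_const has_derivative_cmod_square)
  moreover have "((\<lambda>v. of_real L * v) has_derivative (\<lambda>h. of_real L * h)) (at w)"
    by (auto intro!: derivative_eq_intros)
  ultimately have "((\<lambda>v. of_real L * v / of_real (1 - (cmod v)\<^sup>2)) has_derivative
      (\<lambda>h. (of_real L * h * U - of_real L * w * of_real (0 - 2 * (Re w * Re h + Im w * Im h))) / (U * U))) (at w)"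
    using U unfolding U_def by (intro has_derivative_divide')
  from wirtinger_eqI(1)[OF w bar this]
  have "wirtinger (wirtinger_bar (\<lambda>v. complex_of_real (f v))) w =
      ((of_real L * U + of_real L * w * (2 * of_real (Re w))) / (U * U) -
        \<i> * ((of_real L * \<i> * U + of_real L * w * (2 * of_real (Im w))) / (U * U))) / 2"
    by simp
  also have "\<dots> = of_real L * (U + w * (of_real (Re w) - \<i> * of_real (Im w))) / U\<^sup>2"
  proof -
    have "((c * u + c * w * (2 * a)) / (u * u) - \<i> * ((c * \<i> * u + c * w * (2 * b)) / (u * u))) / 2 =
        c * (u + w * (a - \<i> * b)) / u\<^sup>2" if "u \<noteq> 0" for a b c u :: complex
      using that by (simp add: field_simps power2_eq_square)
    from this[OF U] show ?thesis .
  qed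
  also have "of_real (Re w) - \<i> * of_real (Im w) = cnj w"
    by (simp add: complex_eq_iff)
  also have "U + w * cnj w = 1"
    unfolding U_def of_real_diff complex_norm_square by simp
  finally show ?thesis by (simp add: U_def)
qed

context qh_setting
begin

lemma atom_sqnorm_eq:
  assumes w: "w \<in> disc"
  shows "atom_sqnorm A t i w = (1 - (cmod w)\<^sup>2) powr (- lam t i)"
proof -
  have cw: "cnj w \<in> disc" using w by simp
  have "inprod (A (lam t i)) (atom (lam t i) w) (atom (lam t i) w) = atom (lam t i) w (cnj w)"
    using rkhs_reproducing[OF A_lam cw atom_in[OF w]] by (simp only: atom_eq_kernel_fun)
  also have "\<dots> = of_real (1 - (cmod w)\<^sup>2) powr of_real (- lam t i)"
    using w by (simp add: atom_def complex_norm_square mult.commute del: of_real_power)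
  also have "\<dots> = of_real ((1 - (cmod w)\<^sup>2) powr (- lam t i))"
    using disc_square[OF w] by (intro powr_of_real) simp
  finally show ?thesis
    unfolding atom_sqnorm_def hnorm_power2[OF A_hilbert atom_in[OF w]] by (simp only: Re_complex_of_real)
qed

lemma curvature_eq:
  assumes "w \<in> disc"
  shows "curvature A t i w = - of_real (lam t i / (1 - (cmod w)\<^sup>2)\<^sup>2)"
  unfolding curvature_def
proof (subst wirtinger_log_kernel[OF _ assms])
  show "ln (atom_sqnorm A t i v) = - lam t i * ln (1 - (cmod v)\<^sup>2)" if "v \<in> disc" for v
    using disc_square[OF that] by (simp add: atom_sqnorm_eq[OF that] ln_powr)
qed simp

lemma second_ff_eq:
  assumes w: "w \<in> disc" and x: "x = 1 - (cmod w)\<^sup>2"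
  shows "second_ff A t i w = - (mu t i (i + 1) * of_real (lam t i /
    (x\<^sup>2 * sqrt (x powr (- valency t) + (cmod (mu t i (i + 1)))\<^sup>2 * lam t i / x\<^sup>2))))"
proof -
  have "x > 0" using disc_square[OF w] x by simp
  let ?r = "x powr (- valency t) + (cmod (mu t i (i + 1)))\<^sup>2 * lam t i / x\<^sup>2"
  have "atom_sqnorm A t (i + 1) w / atom_sqnorm A t i w = x powr (- valency t)"
    using \<open>x > 0\<close> unfolding atom_sqnorm_eq[OF w] x[symmetric]
    by (simp add: lam_def algebra_simps flip: powr_diff)
  then have "of_real (atom_sqnorm A t (i + 1) w / atom_sqnorm A t i w)
      - of_real ((cmod (mu t i (i + 1)))\<^sup>2) * curvature A t i w = complex_of_real ?r"
    unfolding curvature_eq[OF w] x[symmetric] by simp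
  moreover have "?r \<ge> 0"
    using lam_pos[of i] by simp
  ultimately have "csqrt (of_real (atom_sqnorm A t (i + 1) w / atom_sqnorm A t i w)
      - of_real ((cmod (mu t i (i + 1)))\<^sup>2) * curvature A t i w) = of_real (sqrt ?r)"
    by (simp only: of_real_sqrt)
  then show ?thesis
    unfolding second_ff_def curvature_eq[OF w] x[symmetric] by (simp add: field_simps)
qed

text \<open>
  Clearing denominators leaves a single term, \<open>x powr (2 - valency t)\<close>, that depends on the point.
\<close>

lemma second_ff_square:
  assumes w: "w \<in> disc" and x: "x = 1 - (cmod w)\<^sup>2"
  shows "x\<^sup>2 * (cmod (second_ff A t i w))\<^sup>2 =
    (cmod (mu t i (i + 1)) * lam t i)\<^sup>2 / (x powr (2 - valency t) + (cmod (mu t i (i + 1)))\<^sup>2 * lam t i)"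
proof -
  have x0: "x > 0" using disc_square[OF w] x by simp
  let ?m = "cmod (mu t i (i + 1))"
  have r: "x powr (- valency t) + ?m\<^sup>2 * lam t i / x\<^sup>2 > 0"
    using lam_pos[of i] x0 by (intro add_pos_nonneg) auto
  have "x powr (2 - valency t) = x\<^sup>2 * x powr (- valency t)"
    using x0 by (simp add: powr_diff powr_minus divide_inverse powr_numeral)
  then have den: "x powr (2 - valency t) + ?m\<^sup>2 * lam t i = x\<^sup>2 * (x powr (- valency t) + ?m\<^sup>2 * lam t i / x\<^sup>2)"
    using x0 by (simp add: field_simps)
  have "(cmod (second_ff A t i w))\<^sup>2 = (?m * lam t i)\<^sup>2 / (x\<^sup>2 * (x\<^sup>2 * (x powr (- valency t) + ?m\<^sup>2 * lam t i / x\<^sup>2)))"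
    unfolding second_ff_eq[OF w x] using r x0
    by (simp add: norm_mult norm_divide norm_power power_mult_distrib power_divide)
  moreover have "x\<^sup>2 * (N / (x\<^sup>2 * D)) = N / D" for N D
    using x0 by simp
  ultimately show ?thesis
    unfolding den by (simp only:)
qed

end

text \<open>
  In terms of \<open>y = x powr (2 - valency t)\<close> the equality of the moduli is linear in \<open>y\<close>, after
  clearing denominators. As the valency is not \<open>2\<close>, the points \<open>0\<close> and \<open>1/2\<close> give different
  values of \<open>y\<close>, so both coefficients of this linear relation can be compared. They yield the
  parameter and the modulus of the constant; its argument is that of \<open>- second_ff A t i 0\<close>.
\<close>

lemma second_ff_determines:
  assumes "qh_setting A n t" "qh_setting A n t'"
    and val: "valency t = valency t'" "valency t < 2" and i: "i + 1 < n"
    and eq: "\<And>w. w \<in> disc \<Longrightarrow> second_ff A t i w = second_ff A t' i w"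
  shows "lam t i = lam t' i" "mu t i (i + 1) = mu t' i (i + 1)"
proof -
  interpret t: qh_setting A n t by fact
  interpret t': qh_setting A n t' by fact
  define a where "a = (cmod (mu t i (i + 1)))\<^sup>2"
  define a' where "a' = (cmod (mu t' i (i + 1)))\<^sup>2"
  define L where "L = lam t i"
  define L' where "L' = lam t' i"
  have "mu t i (i + 1) \<noteq> 0" "mu t' i (i + 1) \<noteq> 0"
    using t.qh t'.qh i unfolding quasi_homogeneous_def by auto
  then have pos: "a > 0" "a' > 0" "L > 0" "L' > 0"
    using t.lam_pos t'.lam_pos by (auto simp: a_def a'_def L_def L'_def)
  have cross: "a * L\<^sup>2 * (y + a' * L') = a' * L'\<^sup>2 * (y + a * L)"
    if w: "w \<in> disc" and y: "y = (1 - (cmod w)\<^sup>2) powr (2 - valency t)" for w y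
  proof -
    have "a * L\<^sup>2 / (y + a * L) = a' * L'\<^sup>2 / (y + a' * L')"
      using t.second_ff_square[OF w refl, of i] t'.second_ff_square[OF w refl, of i] eq[OF w]
      by (simp add: a_def a'_def L_def L'_def y val(1) power_mult_distrib)
    moreover have "y + a * L > 0" "y + a' * L' > 0"
      using pos by (auto simp: y intro!: add_nonneg_pos)
    ultimately show ?thesis by (simp add: field_simps)
  qed
  define y where "y = (1 - (cmod (1/2))\<^sup>2) powr (2 - valency t)"
  have "y < 1"
    using val(2) powr_less_mono2[of "2 - valency t" "3/4" 1] by (simp add: y_def power2_eq_square)
  have e1: "a * L\<^sup>2 * (1 + a' * L') = a' * L'\<^sup>2 * (1 + a * L)"
    by (rule cross[of 0]) simp_all
  moreover have e2: "a * L\<^sup>2 * (y + a' * L') = a' * L'\<^sup>2 * (y + a * L)"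
    by (rule cross[OF _ y_def]) simp
  ultimately have "(a * L\<^sup>2 - a' * L'\<^sup>2) * (1 - y) = 0"
    by (simp add: algebra_simps)
  then have s: "a * L\<^sup>2 = a' * L'\<^sup>2" using \<open>y < 1\<close> by simp
  with e1 pos have "1 + a' * L' = 1 + a * L" by simp
  then have "a * L = a' * L'" by simp
  moreover have "(a * L) * L = (a' * L') * L'"
    using s by (simp add: power2_eq_square mult.assoc)
  ultimately have LL: "L = L'" using pos by simp
  then show "lam t i = lam t' i" by (simp add: L_def L'_def)
  have "a = a'" using \<open>a * L = a' * L'\<close> LL pos by simp
  define c where "c = L / (1\<^sup>2 * sqrt (1 powr (- valency t) + a * L / 1\<^sup>2))"
  have "second_ff A t i 0 = - (mu t i (i + 1) * of_real c)"
    unfolding c_def a_def L_def by (rule t.second_ff_eq) simp_all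
  moreover have "second_ff A t' i 0 = - (mu t' i (i + 1) * of_real c)"
    unfolding c_def val(1) \<open>a = a'\<close> LL unfolding a'_def L'_def by (rule t'.second_ff_eq) simp_all
  moreover have "c > 0"
    using pos by (simp add: c_def add_pos_pos)
  ultimately show "mu t i (i + 1) = mu t' i (i + 1)"
    using eq[of 0] by simp
qed

section \<open>Similarity of quasi-homogeneous curves\<close>

theorem theorem3p1:
  fixes A :: "real \<Rightarrow> complex hspace"
    and n :: nat
    and t t' :: qh_data
  assumes A: "\<And>l. l > 0 \<Longrightarrow> disc_rkhs l (A l)"
    and n: "n \<ge> 2"
    and t: "quasi_homogeneous A n t"
    and t': "quasi_homogeneous A n t'"
  shows "(valency t \<ge> 2 \<longrightarrow>
            similar_curves (ambient A n t) (qh_curve n t) (ambient A n t) (atoms_sum_curve n t)) \<and>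
         (valency t = valency t' \<and> valency t < 2 \<and>
          (\<forall>i\<le>n - 2. \<forall>w\<in>disc. second_ff A t i w = second_ff A t' i w) \<longrightarrow>
            (similar_curves (ambient A n t) (qh_curve n t) (ambient A n t') (qh_curve n t') \<longleftrightarrow>
             (\<forall>w\<in>disc. qh_curve n t w = qh_curve n t' w)))"
proof (intro conjI impI)
  have st: "qh_setting A n t" and st': "qh_setting A n t'"
    using A t t' by unfold_locales auto
  interpret t: qh_setting A n t by (rule st)
  show "similar_curves (ambient A n t) (qh_curve n t) (ambient A n t) (atoms_sum_curve n t)"
    if "valency t \<ge> 2"
    by (rule t.atoms_sum_similar[OF that])
  assume *: "valency t = valency t' \<and> valency t < 2 \<and>
    (\<forall>i\<le>n - 2. \<forall>w\<in>disc. second_ff A t i w = second_ff A t' i w)"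
  then have val: "valency t = valency t'" "valency t < 2" by auto
  have data: "lam t i = lam t' i" "mu t i (i + 1) = mu t' i (i + 1)" if "i + 1 < n" for i
  proof -
    have "second_ff A t i w = second_ff A t' i w" if "w \<in> disc" for w
      using * \<open>i + 1 < n\<close> that by simp
    from second_ff_determines[OF st st' val \<open>i + 1 < n\<close> this]
    show "lam t i = lam t' i" "mu t i (i + 1) = mu t' i (i + 1)" by blast+
  qed
  have "lam0 t = lam0 t'"
    using data(1)[of 0] n by (simp add: lam_def)
  then have lam: "lam t' = lam t"
    using val(1) by (simp add: lam_def fun_eq_iff)
  then have amb: "ambient A n t' = ambient A n t"
    by (simp add: ambient_def)
  show "similar_curves (ambient A n t) (qh_curve n t) (ambient A n t') (qh_curve n t') \<longleftrightarrow>
      (\<forall>w\<in>disc. qh_curve n t w = qh_curve n t' w)"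
  proof
    assume "\<forall>w\<in>disc. qh_curve n t w = qh_curve n t' w"
    then show "similar_curves (ambient A n t) (qh_curve n t) (ambient A n t') (qh_curve n t')"
      unfolding similar_curves_def bounded_invertible_op_def amb
      by (intro exI[of _ "\<lambda>f. f"] conjI bounded_op_id) auto
  next
    assume "similar_curves (ambient A n t) (qh_curve n t) (ambient A n t') (qh_curve n t')"
    then obtain X Y where X: "bounded_op (ambient A n t) (ambient A n t) X"
      and Y: "bounded_op (ambient A n t) (ambient A n t) Y"
      and YX: "\<And>f. f \<in> hcar (ambient A n t) \<Longrightarrow> Y (X f) = f"
      and img: "\<And>w. w \<in> disc \<Longrightarrow> X ` qh_curve n t w = qh_curve n t' w"
      unfolding similar_curves_def bounded_invertible_op_def amb by blast
    interpret qh_intertwiner A n t t' X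
    proof unfold_locales
      show "disc_rkhs l (A l)" if "l > 0" for l by (rule A[OF that])
      show "quasi_homogeneous A n t'" by (rule t')
      show "lam t' = lam t" by (rule lam)
      show "bounded_op (ambient A n t) (ambient A n t) X" by (rule X)
      show "X (frame t j w) \<in> qh_curve n t' w" if "w \<in> disc" "j < n" for w j
        using that img[OF that(1), symmetric] by (auto simp: qh_curve_def intro: cfun.span_base)
    qed
    have inj: "f = 0" if "f \<in> hcar (ambient A n t)" "X f = 0" for f
      using YX[OF that(1)] that(2) bounded_op_0[OF t.ambient_hilbert Y] by simp
    have "valency t > 0"
      using t unfolding quasi_homogeneous_def by blast
    then have mu: "mu t i j = mu t' i j" if "i \<le> j" "j < n" for i j
      by (rule mu_eq[OF _ val(2) that data(2) inj])
    have "frame t j w = frame t' j w" if "j < n" for j w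
      unfolding frame_def lam using mu that by (intro sum.cong) auto
    then show "\<forall>w\<in>disc. qh_curve n t w = qh_curve n t' w"
      by (auto simp: qh_curve_def intro!: arg_cong[where f = cfun.span] image_cong)
  qed
qed

end
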